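(* Let $\gamma$ be the Euler--Mascheroni constant and $D:=\frac{e^{1-\frac12\gamma}}{\sqrt2}$. Let $(R_n)_{n\ge 1}$ be the sequence given by $R_1=1$ and $$R_{n}:=\sqrt{2}\left( D^{k-1}+(j_{n}-1)\left(\frac{D^{k}-D^{k-1}}{2^{k-1}}\right)\right)\quad\text{whenever } n\in B_k,\ k\ge 1,$$ where $B_k:=\{2^{k-1}+1,\ldots,2^k\}$ and $j_n$ is the position of $n$ in the order of the elements of $B_k$ (that is, $j_n=n-2^{k-1}$). Then: (a) $(R_n)_{n\ge1}$ satisfies the (real) multilinear Bohnenblust--Hille inequality; (b) the sequence of differences $(R_{n+1}-R_n)_{n=1}^{\infty}$ is decreasing (monotone and non-increasing) and converges to zero; (c) for all $n\ge 1$, $$R_{n+1}-R_{n}\leq\left( 2\sqrt{2}-4e^{\frac{1}{2}\gamma-1}\right) n^{\log_{2}\left( 2^{-3/2}e^{1-\frac{1}{2}\gamma}\right)};$$ numerically, $$R_{n+1}-R_{n}<\frac{0.87}{n^{0.473678}}\quad\text{for all } n\ge1.$$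
   Context: A sequence $(C_n)_{n\ge1}$ in $[1,\infty)$ is said to satisfy the (real) multilinear Bohnenblust--Hille inequality if for every positive integer $n$, every positive integer $N$ and every $n$-linear form $U:\mathbb{R}^N\times\cdots\times\mathbb{R}^N\to\mathbb{R}$, $$\left(\sum_{i_1,\ldots,i_n=1}^N |U(e_{i_1},\ldots,e_{i_n})|^{\frac{2n}{n+1}}\right)^{\frac{n+1}{2n}}\le C_n\,\sup|U(z_1,\ldots,z_n)|,$$ where $(e_i)_{i=1}^N$ is the canonical basis of $\mathbb{R}^N$ and the supremum is over all $z_1,\ldots,z_n$ in the open unit ball of $\mathbb{R}^N$ with the sup norm. The Euler--Mascheroni constant is $\gamma=\lim_{m\to\infty}\left(-\log m+\sum_{k=1}^m \frac1k\right)\approx0.5772$.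
   Formalization: In (b) the differences R_{n+1}-R_n are claimed non-increasing only from n=2 on: at n=1 the claim fails, since R_2-R_1 = √2-1 ≈ 0.414 is smaller than R_3-R_2 = √2(D-1) ≈ 0.623. *)

theory Defs
  imports "HOL-Analysis.Analysis"
begin

text \<open>The dimension \<open>N\<close> and the arity \<open>n\<close> are quantified inside the definition of the
  Bohnenblust--Hille inequality, so vectors of \<open>\<real>\<^sup>N\<close> are extensional functions on \<open>{1..N}\<close>, and
  \<open>n\<close>-tuples of vectors are extensional functions on \<open>{1..n}\<close>.\<close>

definition rvecs :: "nat \<Rightarrow> (nat \<Rightarrow> real) set" where
  "rvecs N = ({1..N} \<rightarrow>\<^sub>E UNIV)"

definition lincomb :: "nat \<Rightarrow> real \<Rightarrow> (nat \<Rightarrow> real) \<Rightarrow> real \<Rightarrow> (nat \<Rightarrow> real) \<Rightarrow> (nat \<Rightarrow> real)" where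
  "lincomb N a x b y = (\<lambda>j\<in>{1..N}. a * x j + b * y j)"

definition canonical_vec :: "nat \<Rightarrow> nat \<Rightarrow> (nat \<Rightarrow> real)" where
  "canonical_vec N i = (\<lambda>j\<in>{1..N}. if j = i then 1 else 0)"

definition sup_norm :: "nat \<Rightarrow> (nat \<Rightarrow> real) \<Rightarrow> real" where
  "sup_norm N x = Max ((\<lambda>j. \<bar>x j\<bar>) ` {1..N})"

definition sup_ball :: "nat \<Rightarrow> (nat \<Rightarrow> real) set" where
  "sup_ball N = {x \<in> rvecs N. sup_norm N x < 1}"

definition multilinear_form :: "nat \<Rightarrow> nat \<Rightarrow> ((nat \<Rightarrow> nat \<Rightarrow> real) \<Rightarrow> real) \<Rightarrow> bool" where
  "multilinear_form n N U \<longleftrightarrow>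
     (\<forall>z \<in> {1..n} \<rightarrow>\<^sub>E rvecs N. \<forall>k \<in> {1..n}. \<forall>x \<in> rvecs N. \<forall>y \<in> rvecs N. \<forall>a b.
        U (z(k := lincomb N a x b y)) = a * U (z(k := x)) + b * U (z(k := y)))"

text \<open>For \<open>n, N \<ge> 1\<close> and multilinear \<open>U\<close> the supremum is over a nonempty bounded set of reals,
  so it is the genuine one.\<close>

definition form_norm :: "nat \<Rightarrow> nat \<Rightarrow> ((nat \<Rightarrow> nat \<Rightarrow> real) \<Rightarrow> real) \<Rightarrow> real" where
  "form_norm n N U = (SUP z \<in> {1..n} \<rightarrow>\<^sub>E sup_ball N. \<bar>U z\<bar>)"

text \<open>Sequences are indexed from 1; the value at 0 is irrelevant.\<close>

definition satisfies_BH :: "(nat \<Rightarrow> real) \<Rightarrow> bool" where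
  "satisfies_BH C \<longleftrightarrow>
     (\<forall>n\<ge>1. C n \<ge> 1) \<and>
     (\<forall>n\<ge>1. \<forall>N\<ge>1. \<forall>U. multilinear_form n N U \<longrightarrow>
        (\<Sum>i \<in> {1..n} \<rightarrow>\<^sub>E {1..N}.
            \<bar>U (\<lambda>k\<in>{1..n}. canonical_vec N (i k))\<bar> powr (2 * real n / (real n + 1)))
          powr ((real n + 1) / (2 * real n))
        \<le> C n * form_norm n N U)"

definition D_const :: real where
  "D_const = exp (1 - euler_mascheroni / 2) / sqrt 2"

definition dyadic_block :: "nat \<Rightarrow> nat set" where
  "dyadic_block k = {2 ^ (k - 1) + 1..2 ^ k}"

definition block_index :: "nat \<Rightarrow> nat" where
  "block_index n = (THE k. k \<ge> 1 \<and> n \<in> dyadic_block k)"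

definition position :: "nat \<Rightarrow> nat" where
  "position n = n - 2 ^ (block_index n - 1)"

definition R :: "nat \<Rightarrow> real" where
  "R n = (if n = 1 then 1 else
     (let k = block_index n in
        sqrt 2 * (D_const ^ (k - 1) + (real (position n) - 1) * ((D_const ^ k - D_const ^ (k - 1)) / 2 ^ (k - 1)))))"

lemma block_index_unique:
  assumes "k \<ge> 1" "n \<in> dyadic_block k"
  shows "block_index n = k"
  unfolding block_index_def
proof (rule the_equality)
  show "k \<ge> 1 \<and> n \<in> dyadic_block k" using assms by simp
  fix l assume l: "l \<ge> 1 \<and> n \<in> dyadic_block l"
  have *: "i \<le> j" if "i \<ge> 1" "n \<in> dyadic_block i" "n \<in> dyadic_block j" for i j
  proof (rule ccontr)
    assume "\<not> i \<le> j"
    hence "(2::nat) ^ j \<le> 2 ^ (i - 1)" by (intro power_increasing) auto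
    moreover have "n \<le> 2 ^ j" "2 ^ (i - 1) < n" using that by (auto simp: dyadic_block_def)
    ultimately show False by linarith
  qed
  show "l = k" using * [of l k] * [of k l] l assms by simp
qed

lemma R_block:
  assumes "k \<ge> 1" "n \<in> dyadic_block k"
  shows "R n = sqrt 2 * (D_const ^ (k - 1) +
    (real (n - 2 ^ (k - 1)) - 1) * ((D_const ^ k - D_const ^ (k - 1)) / 2 ^ (k - 1)))"
proof -
  have "n \<noteq> 1" using assms by (auto simp: dyadic_block_def)
  thus ?thesis by (simp add: R_def position_def block_index_unique [OF assms] Let_def)
qed

text \<open>The first difference is strictly smaller than the second one, so the differences can only
  be non-increasing from index 2 on.\<close>

lemma R_first_differences: "R 2 - R 1 < R 3 - R 2"
proof -
  have R2: "R 2 = sqrt 2" using R_block [of 1 2] by (simp add: dyadic_block_def)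
  have R3: "R 3 = sqrt 2 * D_const" using R_block [of 2 3] by (simp add: dyadic_block_def)
  have R1: "R 1 = 1" by (simp add: R_def)
  let ?x = "1 - euler_mascheroni / 2 :: real"
  have x: "?x > 7/10" using euler_mascheroni_less_13_over_22 by simp
  have "(7/10)\<^sup>2 \<le> ?x\<^sup>2" using x by (intro power_mono) auto
  moreover have "1 + ?x + ?x\<^sup>2 / 2 \<le> exp ?x" using x by (intro exp_lower_Taylor_quadratic) auto
  ultimately have "exp ?x > 19/10" using x by (simp add: power2_eq_square)
  moreover have "sqrt 2 < 1.42" by (rule real_less_lsqrt) (auto simp: power2_eq_square)
  ultimately show ?thesis unfolding R2 R3 R1 by (simp add: D_const_def)
qed

end

theory Submission
  imports Defs
begin

text \<open>The Bohnenblust--Hille inequality is proved with the constants \<open>C\<^sub>1 = 1\<close> and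
  \<open>C\<^sub>n = sqrt (2 (n - 1))\<close> for \<open>n \<ge> 2\<close>, and \<open>C\<^sub>n \<le> R n\<close> (\<open>sqrt_le_R\<close>), since \<open>R n\<close> grows like \<open>n\<close> to the
  power \<open>log 2 D \<approx> 0.526\<close>.

  The constants come from an induction on the number \<open>n\<close> of slots (\<open>BH_bound_step\<close>). Random signs in one
  slot turn an \<open>n\<close>-linear form into an \<open>(n - 1)\<close>-linear one. Averaging its inequality, whose exponent is
  \<open>p = 2 (n - 1) / n\<close>, and applying Khinchine's inequality to the signs bounds a mixed norm of the
  coefficients, with exponent \<open>2\<close> in the chosen slot and \<open>p\<close> in the others. This works for each slot, and
  Blei's inequality (\<open>blei\<close>) combines the \<open>n\<close> mixed norms to the norm with exponent \<open>2 n / (n + 1)\<close>. Hence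
  \<open>C\<^sub>n\<close> is \<open>C\<^bsub>n - 1\<^esub>\<close> times the Khinchine constant for \<open>p\<close>.

  For \<open>n = 2\<close> this constant is the \<open>sqrt 2\<close> of Szarek (\<open>szarek\<close>), which follows from a spectral gap for even
  functions on the cube. For \<open>n \<ge> 3\<close> it is controlled by \<open>E (f\<^sup>2 ln \<bar>f\<bar>)\<close> for a normalised sum \<open>f\<close> of random signs:
  if this is at most \<open>s\<close>, then \<open>C\<^sub>n\<close> grows at most like \<open>n\<close> to the power \<open>s\<close>. The first, second and fourth
  moments of \<open>f\<close> give \<open>s = 1/2\<close> (\<open>rsum_entropy_le\<close>), less than \<open>log 2 D\<close>.

  As a function of \<open>n - 1\<close> the sequence \<open>R\<close> is linear between consecutive powers of two (\<open>R_Suc\<close>), so its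
  differences are \<open>sqrt 2 (D - 1) (D / 2) ^ j\<close> for \<open>2 ^ j < n \<le> 2 ^ (j + 1)\<close>. Monotonicity, the limit and the
  bound in terms of \<open>n\<close> follow from \<open>D < 2\<close>. The numerical bound for all \<open>n\<close> also needs
  \<open>log 2 (D / 2) \<le> - 0.473678\<close>, which is true by a margin of only \<open>5 * 10 ^ (- 8)\<close>; this is where Euler's
  constant has to be known accurately (\<open>gamma_lower_le\<close>).\<close>

section \<open>Averages over signs\<close>

definition rsign :: "'j set \<Rightarrow> 'j \<Rightarrow> real" where
  "rsign S j = (if j \<in> S then 1 else -1)"

text \<open>Signs \<open>\<epsilon> \<in> {-1, 1}\<^sup>A\<close> are encoded by the set \<open>S \<subseteq> A\<close> of indices where the sign is \<open>+1\<close>, so that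
  adjoining a coordinate to the cube becomes \<open>Pow_insert\<close>.\<close>

definition rmean :: "'j set \<Rightarrow> ('j set \<Rightarrow> real) \<Rightarrow> real" where
  "rmean A F = (\<Sum>S\<in>Pow A. F S) / 2 ^ card A"

definition rsum :: "('j \<Rightarrow> real) \<Rightarrow> 'j set \<Rightarrow> 'j set \<Rightarrow> real" where
  "rsum a A S = (\<Sum>j\<in>A. a j * rsign S j)"

lemma rmean_empty [simp]: "rmean {} F = F {}"
  by (simp add: rmean_def)

lemma rmean_insert:
  assumes "finite A" "x \<notin> A"
  shows "rmean (insert x A) F = rmean A (\<lambda>S. (F S + F (insert x S)) / 2)"
proof -
  have "inj_on (insert x) (Pow A)"
    using assms(2) by (auto simp: inj_on_def)
  moreover have "Pow A \<inter> insert x ` Pow A = {}"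
    using assms(2) by auto
  ultimately have "(\<Sum>S\<in>Pow (insert x A). F S) = (\<Sum>S\<in>Pow A. F S) + (\<Sum>S\<in>Pow A. F (insert x S))"
    using assms(1) by (simp add: Pow_insert sum.union_disjoint sum.reindex)
  then show ?thesis
    using assms by (simp add: rmean_def sum.distrib sum_divide_distrib [symmetric] field_simps)
qed

lemma rmean_cong: "(\<And>S. S \<subseteq> A \<Longrightarrow> F S = G S) \<Longrightarrow> rmean A F = rmean A G"
  by (simp add: rmean_def)

lemma rmean_mono: "(\<And>S. S \<subseteq> A \<Longrightarrow> F S \<le> G S) \<Longrightarrow> rmean A F \<le> rmean A G"
  unfolding rmean_def by (intro divide_right_mono sum_mono) auto

lemma rmean_nonneg: "(\<And>S. S \<subseteq> A \<Longrightarrow> 0 \<le> F S) \<Longrightarrow> 0 \<le> rmean A F"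
  unfolding rmean_def by (intro divide_nonneg_nonneg sum_nonneg) auto

lemma rmean_add: "rmean A (\<lambda>S. F S + G S) = rmean A F + rmean A G"
  by (simp add: rmean_def sum.distrib add_divide_distrib)

lemma rmean_diff: "rmean A (\<lambda>S. F S - G S) = rmean A F - rmean A G"
  by (simp add: rmean_def sum_subtractf diff_divide_distrib)

lemma rmean_cmult: "rmean A (\<lambda>S. c * F S) = c * rmean A F"
  by (simp add: rmean_def sum_distrib_left)

lemma rmean_divide: "rmean A (\<lambda>S. F S / c) = rmean A F / c"
  by (simp add: rmean_def sum_divide_distrib [symmetric])

lemma rmean_const: "finite A \<Longrightarrow> rmean A (\<lambda>_. c) = c"
  by (simp add: rmean_def card_Pow)

lemma rmean_sum: "rmean A (\<lambda>S. \<Sum>i\<in>I. F i S) = (\<Sum>i\<in>I. rmean A (F i))"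
  unfolding rmean_def by (simp add: sum.swap [of _ I] sum_divide_distrib)

lemmas rmean_linear = rmean_add rmean_diff rmean_cmult rmean_divide

lemma rsum_insert:
  assumes "finite A" "x \<notin> A"
  shows "S \<subseteq> A \<Longrightarrow> rsum a (insert x A) S = rsum a A S - a x"
    and "rsum a (insert x A) (insert x S) = rsum a A S + a x"
proof -
  show "rsum a (insert x A) S = rsum a A S - a x" if "S \<subseteq> A"
    using assms that by (auto simp: rsum_def rsign_def)
  have "(\<Sum>j\<in>A. a j * rsign (insert x S) j) = (\<Sum>j\<in>A. a j * rsign S j)"
    using assms by (intro sum.cong) (auto simp: rsign_def)
  then show "rsum a (insert x A) (insert x S) = rsum a A S + a x"
    using assms by (simp add: rsum_def rsign_def)
qed

lemma rmean_rsum_insert: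
  assumes "finite A" "x \<notin> A"
  shows "rmean (insert x A) (\<lambda>S. F (rsum a (insert x A) S)) =
    rmean A (\<lambda>S. (F (rsum a A S - a x) + F (rsum a A S + a x)) / 2)"
  unfolding rmean_insert [OF assms]
  by (rule rmean_cong) (simp add: rsum_insert [OF assms])

lemma rsum_second_moment:
  "finite A \<Longrightarrow> rmean A (\<lambda>S. (rsum a A S)\<^sup>2) = (\<Sum>j\<in>A. (a j)\<^sup>2)"
proof (induction A rule: finite_induct)
  case empty
  show ?case by (simp add: rsum_def)
next
  case (insert x A)
  have *: "((u - a x)\<^sup>2 + (u + a x)\<^sup>2) / 2 = u\<^sup>2 + (a x)\<^sup>2" for u
    by (simp add: power2_eq_square algebra_simps)
  show ?case
    using insert
    by (simp add: rmean_rsum_insert [where F = "\<lambda>u. u\<^sup>2"] * rmean_linear rmean_const)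
qed

text \<open>A further summand with coefficient \<open>a\<close> changes a fourth moment \<open>m\<close> to \<open>m + 6 a\<^sup>2 s + a\<^sup>4\<close>, where \<open>s\<close> is
  the second moment; if \<open>m \<le> 3 s\<^sup>2\<close>, this stays below \<open>3 (s + a\<^sup>2)\<^sup>2\<close>.\<close>

lemma rsum_fourth_moment:
  "finite A \<Longrightarrow> rmean A (\<lambda>S. (rsum a A S) ^ 4) \<le> 3 * (\<Sum>j\<in>A. (a j)\<^sup>2)\<^sup>2"
proof (induction A rule: finite_induct)
  case empty
  show ?case by (simp add: rsum_def)
next
  case (insert x A)
  have *: "((u - a x) ^ 4 + (u + a x) ^ 4) / 2 = u ^ 4 + 6 * (a x)\<^sup>2 * u\<^sup>2 + (a x) ^ 4" for u
    by (simp add: power2_eq_square power4_eq_xxxx algebra_simps)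
  let ?s = "\<Sum>j\<in>A. (a j)\<^sup>2"
  have pos: "0 \<le> (a x) ^ 4" by simp
  have "rmean (insert x A) (\<lambda>S. (rsum a (insert x A) S) ^ 4) =
      rmean A (\<lambda>S. (rsum a A S) ^ 4) + 6 * (a x)\<^sup>2 * ?s + (a x) ^ 4"
    using insert
    by (simp add: rmean_rsum_insert [where F = "\<lambda>u. u ^ 4"] * rmean_linear rmean_const
        rsum_second_moment)
  also have "\<dots> \<le> 3 * ?s\<^sup>2 + 6 * (a x)\<^sup>2 * ?s + 3 * (a x) ^ 4"
    using insert.IH pos by linarith
  also have "\<dots> = 3 * (\<Sum>j\<in>insert x A. (a j)\<^sup>2)\<^sup>2"
    using insert by (simp add: power2_eq_square power4_eq_xxxx algebra_simps)
  finally show ?case .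
qed

definition flip :: "'j \<Rightarrow> 'j set \<Rightarrow> 'j set" where
  "flip i S = (if i \<in> S then S - {i} else insert i S)"

text \<open>The Dirichlet form of the simple random walk on the cube: on the Walsh character of a set \<open>T\<close> it
  takes the value \<open>card T\<close>.\<close>

definition dirichlet :: "'j set \<Rightarrow> ('j set \<Rightarrow> real) \<Rightarrow> real" where
  "dirichlet A h = (\<Sum>i\<in>A. rmean A (\<lambda>S. (h S - h (flip i S))\<^sup>2) / 4)"

lemma dirichlet_nonneg: "0 \<le> dirichlet A h"
  unfolding dirichlet_def by (intro sum_nonneg divide_nonneg_nonneg rmean_nonneg) auto

lemma rmean_flip:
  assumes "i \<in> A"
  shows "rmean A (\<lambda>S. F (flip i S)) = rmean A F"
proof -
  have "(\<Sum>S\<in>Pow A. F (flip i S)) = (\<Sum>S\<in>Pow A. F S)"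
    by (rule sum.reindex_bij_witness [where i = "flip i" and j = "flip i"])
      (use assms in \<open>auto simp: flip_def\<close>)
  then show ?thesis by (simp add: rmean_def)
qed

text \<open>Splitting \<open>h\<close> along the coordinate \<open>x\<close> as \<open>u h \<pm> v h\<close> decouples the Dirichlet form; this drives the
  two inductions below, which replace the Walsh expansion.\<close>

lemma dirichlet_insert:
  assumes "finite A" "x \<notin> A"
  defines "u \<equiv> \<lambda>h S. (h S + h (insert x S)) / (2::real)"
    and "v \<equiv> \<lambda>h S. (h S - h (insert x S)) / (2::real)"
  shows "dirichlet (insert x A) h = dirichlet A (u h) + dirichlet A (v h) + rmean A (\<lambda>S. (v h S)\<^sup>2)"
proof -
  have flip_x: "rmean (insert x A) (\<lambda>S. (h S - h (flip x S))\<^sup>2) / 4 = rmean A (\<lambda>S. (v h S)\<^sup>2)"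
    unfolding rmean_insert [OF assms(1,2)] rmean_divide [symmetric]
  proof (rule rmean_cong)
    fix S assume "S \<subseteq> A"
    then have "flip x S = insert x S" "flip x (insert x S) = S"
      using assms(2) by (auto simp: flip_def)
    then show "((h S - h (flip x S))\<^sup>2 + (h (insert x S) - h (flip x (insert x S)))\<^sup>2) / 2 / 4 = (v h S)\<^sup>2"
      by (simp add: v_def power2_eq_square field_simps)
  qed
  have flip_i: "rmean (insert x A) (\<lambda>S. (h S - h (flip i S))\<^sup>2) / 4 =
      rmean A (\<lambda>S. (u h S - u h (flip i S))\<^sup>2) / 4 + rmean A (\<lambda>S. (v h S - v h (flip i S))\<^sup>2) / 4"
    if "i \<in> A" for i
    unfolding rmean_insert [OF assms(1,2)] rmean_divide [symmetric] rmean_add [symmetric]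
  proof (rule rmean_cong)
    fix S assume "S \<subseteq> A"
    then have "flip i (insert x S) = insert x (flip i S)"
      using assms(2) that by (auto simp: flip_def)
    then show "((h S - h (flip i S))\<^sup>2 + (h (insert x S) - h (flip i (insert x S)))\<^sup>2) / 2 / 4 =
        (u h S - u h (flip i S))\<^sup>2 / 4 + (v h S - v h (flip i S))\<^sup>2 / 4"
      by (simp add: u_def v_def power2_eq_square field_simps)
  qed
  show ?thesis
    using assms(1,2) by (simp add: dirichlet_def flip_x flip_i sum.distrib)
qed

lemma rmean_antipode_insert:
  assumes "finite A" "x \<notin> A"
  shows "rmean (insert x A) (\<lambda>S. F (h S) (h (insert x A - S))) =
    rmean A (\<lambda>S. (F (h S) (h (insert x (A - S))) + F (h (insert x S)) (h (A - S))) / 2)"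
  unfolding rmean_insert [OF assms]
proof (rule rmean_cong)
  fix S assume "S \<subseteq> A"
  then have "insert x A - S = insert x (A - S)" "insert x A - insert x S = A - S"
    using assms(2) by auto
  then show "(F (h S) (h (insert x A - S)) + F (h (insert x S)) (h (insert x A - insert x S))) / 2 =
      (F (h S) (h (insert x (A - S))) + F (h (insert x S)) (h (A - S))) / 2"
    by simp
qed

text \<open>In Walsh coefficients the inequality reads \<open>1 \<le> d\<close> on characters of odd degree \<open>d\<close> and
  \<open>1 \<le> d + 1\<close> on those of even degree.\<close>

lemma square_le_dirichlet_plus_even_part:
  "finite A \<Longrightarrow>
    rmean A (\<lambda>S. (h S)\<^sup>2) \<le> dirichlet A h + rmean A (\<lambda>S. (h S + h (A - S))\<^sup>2) / 4"
proof (induction A arbitrary: h rule: finite_induct)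
  case empty
  show ?case by (simp add: dirichlet_def power2_eq_square)
next
  case (insert x A)
  define u where "u S = (h S + h (insert x S)) / 2" for S
  define v where "v S = (h S - h (insert x S)) / 2" for S
  have sq: "rmean (insert x A) (\<lambda>S. (h S)\<^sup>2) = rmean A (\<lambda>S. (u S)\<^sup>2) + rmean A (\<lambda>S. (v S)\<^sup>2)"
    unfolding rmean_insert [OF insert.hyps] rmean_add [symmetric]
    by (rule rmean_cong) (simp add: u_def v_def power2_eq_square field_simps)
  have anti: "rmean (insert x A) (\<lambda>S. (h S + h (insert x A - S))\<^sup>2) =
      rmean A (\<lambda>S. (u S + u (A - S))\<^sup>2) + rmean A (\<lambda>S. (v S - v (A - S))\<^sup>2)"
    unfolding rmean_antipode_insert [OF insert.hyps, where F = "\<lambda>s t. (s + t)\<^sup>2"] rmean_add [symmetric]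
    by (rule rmean_cong) (simp add: u_def v_def power2_eq_square field_simps)
  have "0 \<le> rmean A (\<lambda>S. (v S - v (A - S))\<^sup>2)"
    by (rule rmean_nonneg) simp
  moreover have dir: "dirichlet (insert x A) h = dirichlet A u + dirichlet A v + rmean A (\<lambda>S. (v S)\<^sup>2)"
    using dirichlet_insert [OF insert.hyps, of h] unfolding u_def v_def .
  ultimately show ?case
    using insert.IH [of u] dirichlet_nonneg [of A v]
    unfolding sq anti dir by argo
qed

text \<open>In Walsh coefficients: on non-constant characters \<open>2 \<le> d\<close> if the degree \<open>d\<close> is even and
  \<open>2 \<le> d + 1\<close> if it is odd. For an even function the last term vanishes, and the spectral gap of
  the cube improves from \<open>1\<close> to \<open>2\<close>.\<close>

lemma variance_le_dirichlet_plus_odd_part: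
  "finite A \<Longrightarrow>
    2 * (rmean A (\<lambda>S. (h S)\<^sup>2) - (rmean A h)\<^sup>2) \<le>
      dirichlet A h + rmean A (\<lambda>S. (h S - h (A - S))\<^sup>2) / 4"
proof (induction A arbitrary: h rule: finite_induct)
  case empty
  show ?case by (simp add: dirichlet_def)
next
  case (insert x A)
  define u where "u S = (h S + h (insert x S)) / 2" for S
  define v where "v S = (h S - h (insert x S)) / 2" for S
  have mean: "rmean (insert x A) h = rmean A u"
    unfolding rmean_insert [OF insert.hyps] u_def ..
  have sq: "rmean (insert x A) (\<lambda>S. (h S)\<^sup>2) = rmean A (\<lambda>S. (u S)\<^sup>2) + rmean A (\<lambda>S. (v S)\<^sup>2)"
    unfolding rmean_insert [OF insert.hyps] rmean_add [symmetric]
    by (rule rmean_cong) (simp add: u_def v_def power2_eq_square field_simps)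
  have anti: "rmean (insert x A) (\<lambda>S. (h S - h (insert x A - S))\<^sup>2) =
      rmean A (\<lambda>S. (u S - u (A - S))\<^sup>2) + rmean A (\<lambda>S. (v S + v (A - S))\<^sup>2)"
    unfolding rmean_antipode_insert [OF insert.hyps, where F = "\<lambda>s t. (s - t)\<^sup>2"] rmean_add [symmetric]
    by (rule rmean_cong) (simp add: u_def v_def power2_eq_square field_simps)
  have dir: "dirichlet (insert x A) h = dirichlet A u + dirichlet A v + rmean A (\<lambda>S. (v S)\<^sup>2)"
    using dirichlet_insert [OF insert.hyps, of h] unfolding u_def v_def .
  show ?case
    using insert.IH [of u] square_le_dirichlet_plus_even_part [OF insert.hyps(1), of v]
    unfolding mean sq anti dir by argo
qed

lemma rsum_antipode: "S \<subseteq> A \<Longrightarrow> rsum a A (A - S) = - rsum a A S"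
  unfolding rsum_def sum_negf [symmetric] by (rule sum.cong) (auto simp: rsign_def)

lemma rsum_flip:
  assumes "finite A" "i \<in> A"
  shows "rsum a A (flip i S) = rsum a A S - 2 * (a i * rsign S i)"
proof -
  have "(\<Sum>j\<in>A - {i}. a j * rsign (flip i S) j) = (\<Sum>j\<in>A - {i}. a j * rsign S j)"
    by (rule sum.cong) (auto simp: rsign_def flip_def)
  moreover have "rsign (flip i S) i = - rsign S i"
    by (simp add: rsign_def flip_def)
  ultimately show ?thesis
    unfolding rsum_def using assms by (simp add: sum.remove)
qed

text \<open>The flipped values of \<open>f = rsum a A\<close> add up to \<open>(card A - 2) f\<close>, so those of \<open>\<bar>f\<bar>\<close> add up to at
  least \<open>(card A - 2) \<bar>f\<bar>\<close>: the generator of the walk maps \<open>\<bar>f\<bar>\<close> to a function below \<open>\<bar>f\<bar>\<close>.\<close>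

lemma dirichlet_abs_rsum_le:
  assumes "finite A"
  shows "dirichlet A (\<lambda>S. \<bar>rsum a A S\<bar>) \<le> rmean A (\<lambda>S. (rsum a A S)\<^sup>2)"
proof -
  let ?h = "\<lambda>S. \<bar>rsum a A S\<bar>"
  let ?m = "rmean A (\<lambda>S. (rsum a A S)\<^sup>2)"
  let ?N = "real (card A)"
  have summand: "rmean A (\<lambda>S. (?h S - ?h (flip i S))\<^sup>2) = 2 * ?m - 2 * rmean A (\<lambda>S. ?h S * ?h (flip i S))"
    if "i \<in> A" for i
  proof -
    have "(?h S - ?h (flip i S))\<^sup>2 =
        (rsum a A S)\<^sup>2 + (rsum a A (flip i S))\<^sup>2 - 2 * (?h S * ?h (flip i S))" for S
      by (simp add: power2_diff)
    then show ?thesis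
      using rmean_flip [OF that, of "\<lambda>S. (rsum a A S)\<^sup>2"] by (simp add: rmean_linear)
  qed
  have "dirichlet A ?h = (\<Sum>i\<in>A. ?m / 2 - rmean A (\<lambda>S. ?h S * ?h (flip i S)) / 2)"
    unfolding dirichlet_def by (rule sum.cong) (auto simp: summand)
  also have "\<dots> = ?N * ?m / 2 - rmean A (\<lambda>S. ?h S * (\<Sum>i\<in>A. ?h (flip i S))) / 2"
    by (simp add: sum_subtractf sum_divide_distrib [symmetric] sum_distrib_left rmean_sum)
  also have "\<dots> \<le> ?N * ?m / 2 - rmean A (\<lambda>S. (?N - 2) * (rsum a A S)\<^sup>2) / 2"
  proof -
    have "(?N - 2) * (rsum a A S)\<^sup>2 \<le> ?h S * (\<Sum>i\<in>A. ?h (flip i S))" for S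
    proof -
      have "(\<Sum>i\<in>A. rsum a A (flip i S)) = ?N * rsum a A S - 2 * rsum a A S"
        using assms by (simp add: rsum_flip sum_subtractf) (simp add: rsum_def sum_distrib_left)
      then have "(\<Sum>i\<in>A. rsum a A (flip i S)) = (?N - 2) * rsum a A S"
        by (simp add: left_diff_distrib)
      then have "(?N - 2) * ?h S \<le> \<bar>\<Sum>i\<in>A. rsum a A (flip i S)\<bar>"
        by (simp add: abs_mult mult_right_mono)
      also have "\<dots> \<le> (\<Sum>i\<in>A. ?h (flip i S))"
        by (rule sum_abs)
      finally have "?h S * ((?N - 2) * ?h S) \<le> ?h S * (\<Sum>i\<in>A. ?h (flip i S))"
        by (rule mult_left_mono) simp
      moreover have "?h S * ((?N - 2) * ?h S) = (?N - 2) * (?h S)\<^sup>2"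
        by (simp only: power2_eq_square mult_ac)
      ultimately show ?thesis
        by simp
    qed
    then show ?thesis
      by (intro diff_left_mono divide_right_mono rmean_mono) auto
  qed
  also have "\<dots> = ?m"
    by (simp only: rmean_cmult) (simp add: field_simps)
  finally show ?thesis .
qed

text \<open>Khinchine's inequality for the first moment with the optimal constant of Szarek, by the argument of
  Latala and Oleszkiewicz: the even function \<open>\<bar>f\<bar>\<close> has \<open>2 Var \<bar>f\<bar> \<le> dirichlet \<bar>f\<bar> \<le> E f\<^sup>2\<close>, which is
  \<open>E f\<^sup>2 \<le> 2 (E \<bar>f\<bar>)\<^sup>2\<close>.\<close>

lemma szarek:
  assumes "finite A"
  shows "sqrt (\<Sum>j\<in>A. (a j)\<^sup>2) \<le> sqrt 2 * rmean A (\<lambda>S. \<bar>rsum a A S\<bar>)"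
proof -
  let ?h = "\<lambda>S. \<bar>rsum a A S\<bar>"
  have "rmean A (\<lambda>S. (?h S - ?h (A - S))\<^sup>2) = rmean A (\<lambda>_. 0)"
    by (rule rmean_cong) (simp add: rsum_antipode)
  then have "2 * ((\<Sum>j\<in>A. (a j)\<^sup>2) - (rmean A ?h)\<^sup>2) \<le> (\<Sum>j\<in>A. (a j)\<^sup>2)"
    using variance_le_dirichlet_plus_odd_part [OF assms, of ?h] dirichlet_abs_rsum_le [OF assms, of a]
    by (simp add: rsum_second_moment assms rmean_const)
  then have "sqrt (\<Sum>j\<in>A. (a j)\<^sup>2) \<le> sqrt (2 * (rmean A ?h)\<^sup>2)"
    by (intro real_sqrt_le_mono) simp
  also have "\<dots> = sqrt 2 * rmean A ?h"
    by (simp add: real_sqrt_mult rmean_nonneg)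
  finally show ?thesis .
qed

section \<open>Khinchine's inequality below the second moment\<close>

text \<open>The difference of the two sides has a derivative that changes sign exactly at \<open>1/4\<close>, \<open>5/8\<close> and
  \<open>7/4\<close>, so it is enough to compare at the two minima \<open>1/4\<close> and \<open>7/4\<close>. The coefficients come from
  prescribing these three zeros; \<open>1/4\<close> and \<open>7/4\<close> are close to the two atoms of the distribution that
  maximises \<open>E (f\<^sup>2 ln f)\<close> when \<open>E f = 1 / sqrt 2\<close>, \<open>E f\<^sup>2 = 1\<close> and \<open>E f\<^sup>4 = 3\<close>.\<close>

lemma ln_le_laurent:
  fixes t :: real
  assumes "t > 0"
  shows "ln t \<le> 245/3552 / t\<^sup>2 - 266/333 / t + 7/10 + 32/333 * t\<^sup>2"
proof -
  define h where "h t = 245/3552 / t\<^sup>2 - 266/333 / t + 7/10 + 32/333 * t\<^sup>2 - ln t" for t :: real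
  define h' where "h' t = 64/333 * ((t - 1/4) * (t - 5/8) * (t - 7/4) * (t + 21/8)) / t ^ 3" for t :: real
  have deriv: "(h has_real_derivative h' t) (at t)" if "t > 0" for t
  proof -
    have "(h has_real_derivative
        (245/3552 * (- (2 * t) / t ^ 4) + 266/333 / t\<^sup>2 + 64/333 * t - 1 / t)) (at t)"
      unfolding h_def
      by (rule derivative_eq_intros refl | use that in force)+
        (use that in \<open>simp add: divide_simps, algebra\<close>)
    moreover have "245/3552 * (- (2 * t) / t ^ 4) + 266/333 / t\<^sup>2 + 64/333 * t - 1 / t = h' t"
      using that unfolding h'_def
      by (simp add: divide_simps) algebra
    ultimately show ?thesis by simp
  qed
  have ln2: "ln (2::real) \<ge> 6931/10000"
    using ln_approx_bounds [of 2 4] by (simp add: eval_nat_numeral)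
  have ln74: "ln (7/4::real) \<le> 56/100"
    using ln_approx_bounds [of "7/4" 3] by (simp add: eval_nat_numeral)
  have left: "0 \<le> h (1/4)"
  proof -
    have "ln (1/4::real) = - (2 * ln 2)"
      using ln_realpow [of 2 2] by (simp add: ln_div)
    then show ?thesis using ln2 by (simp add: h_def power2_eq_square)
  qed
  have right: "0 \<le> h (7/4)"
    using ln74 by (simp add: h_def power2_eq_square)
  (* On the positive axis only the three factors with positive zeros can change sign. *)
  have sign: "h' t \<le> 0 \<longleftrightarrow> (t - 1/4) * (t - 5/8) * (t - 7/4) \<le> 0"
    "0 \<le> h' t \<longleftrightarrow> 0 \<le> (t - 1/4) * (t - 5/8) * (t - 7/4)" if "t > 0" for t
  proof -
    have "h' t = (64/333 * (t + 21/8) / t ^ 3) * ((t - 1/4) * (t - 5/8) * (t - 7/4))"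
      by (simp add: h'_def)
    moreover have "64/333 * (t + 21/8) / t ^ 3 > 0" using that by simp
    ultimately show "h' t \<le> 0 \<longleftrightarrow> (t - 1/4) * (t - 5/8) * (t - 7/4) \<le> 0"
      "0 \<le> h' t \<longleftrightarrow> 0 \<le> (t - 1/4) * (t - 5/8) * (t - 7/4)"
      by (simp_all only: mult_le_0_iff zero_le_mult_iff) linarith+
  qed
  have "0 \<le> h t"
  proof (cases "t \<le> 5/8")
    case True
    have "h (1/4) \<le> h t"
    proof (cases "t \<le> 1/4")
      case True
      show ?thesis
      proof (rule DERIV_nonpos_imp_nonincreasing [OF True])
        fix s assume s: "t \<le> s" "s \<le> 1/4"
        then have "h' s \<le> 0"
          using assms sign(1) [of s] by (simp add: mult_nonneg_nonpos mult_nonpos_nonpos)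
        then show "\<exists>y. (h has_real_derivative y) (at s) \<and> y \<le> 0"
          using deriv [of s] s assms by auto
      qed
    next
      case False
      show ?thesis
      proof (rule DERIV_nonneg_imp_nondecreasing [of "1/4" t h])
        show "1/4 \<le> t" using False by simp
        fix s assume s: "1/4 \<le> s" "s \<le> t"
        then have "0 \<le> (s - 1/4) * ((s - 5/8) * (s - 7/4))"
          using True by (intro mult_nonneg_nonneg mult_nonpos_nonpos) auto
        then have "0 \<le> h' s"
          using s sign(2) [of s] by (simp add: mult.assoc)
        then show "\<exists>y. (h has_real_derivative y) (at s) \<and> 0 \<le> y"
          using deriv [of s] s by auto
      qed
    qed
    then show ?thesis using left by simp
  next
    case False
    have "h (7/4) \<le> h t"
    proof (cases "t \<le> 7/4")
      case True
      show ?thesis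
      proof (rule DERIV_nonpos_imp_nonincreasing [OF True])
        fix s assume s: "t \<le> s" "s \<le> 7/4"
        then have "h' s \<le> 0"
          using False sign(1) [of s] by (simp add: mult_nonneg_nonpos)
        then show "\<exists>y. (h has_real_derivative y) (at s) \<and> y \<le> 0"
          using deriv [of s] s False by auto
      qed
    next
      case False
      show ?thesis
      proof (rule DERIV_nonneg_imp_nondecreasing [of "7/4" t h])
        show "7/4 \<le> t" using False by simp
        fix s assume s: "7/4 \<le> s" "s \<le> t"
        then have "0 \<le> h' s" by (simp add: h'_def)
        then show "\<exists>y. (h has_real_derivative y) (at s) \<and> 0 \<le> y"
          using deriv [of s] s by auto
      qed
    qed
    then show ?thesis using right by simp
  qed
  then show ?thesis by (simp add: h_def)
qed

lemma square_ln_le: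
  fixes t :: real
  assumes "t \<ge> 0"
  shows "t\<^sup>2 * ln t \<le> 245/3552 - 266/333 * t + 7/10 * t\<^sup>2 + 32/333 * t ^ 4"
proof (cases "t = 0")
  case False
  with assms have t: "t > 0" by simp
  have "t\<^sup>2 * ln t \<le> t\<^sup>2 * (245/3552 / t\<^sup>2 - 266/333 / t + 7/10 + 32/333 * t\<^sup>2)"
    by (intro mult_left_mono ln_le_laurent t) simp
  also have "\<dots> = 245/3552 - 266/333 * t + 7/10 * t\<^sup>2 + 32/333 * t ^ 4"
    using t by (simp add: field_simps power2_eq_square power4_eq_xxxx)
  finally show ?thesis .
qed simp

text \<open>The fourth moment alone would give \<open>(ln 3) / 2 \<approx> 0.549\<close> by convexity of \<open>p \<mapsto> ln E \<bar>f\<bar>\<^sup>p\<close>; adding the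
  first moment brings the bound down to \<open>1/2\<close>.\<close>

lemma rsum_entropy_le:
  assumes "finite A" "(\<Sum>j\<in>A. (a j)\<^sup>2) = 1"
  shows "rmean A (\<lambda>S. (rsum a A S)\<^sup>2 * ln \<bar>rsum a A S\<bar>) \<le> 1/2"
proof -
  have first: "1 \<le> sqrt 2 * rmean A (\<lambda>S. \<bar>rsum a A S\<bar>)"
    using szarek [OF assms(1), of a] assms(2) by simp
  have "sqrt 2 \<le> 1.415"
    by (rule real_le_lsqrt) (auto simp: power2_eq_square)
  moreover have "0 \<le> rmean A (\<lambda>S. \<bar>rsum a A S\<bar>)"
    by (rule rmean_nonneg) simp
  ultimately have "1 \<le> 1.415 * rmean A (\<lambda>S. \<bar>rsum a A S\<bar>)"
    using first by (meson mult_right_mono order_trans)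
  have "rmean A (\<lambda>S. (rsum a A S)\<^sup>2 * ln \<bar>rsum a A S\<bar>) \<le>
      rmean A (\<lambda>S. 245/3552 - 266/333 * \<bar>rsum a A S\<bar> + 7/10 * (rsum a A S)\<^sup>2 + 32/333 * (rsum a A S) ^ 4)"
    using square_ln_le [of "\<bar>rsum a A _\<bar>"] by (intro rmean_mono) simp
  also have "\<dots> = 245/3552 - 266/333 * rmean A (\<lambda>S. \<bar>rsum a A S\<bar>) + 7/10 +
      32/333 * rmean A (\<lambda>S. (rsum a A S) ^ 4)"
    by (simp add: rmean_linear rmean_const assms rsum_second_moment)
  also have "\<dots> \<le> 1/2"
    using \<open>1 \<le> 1.415 * _\<close> rsum_fourth_moment [OF assms(1), of a] assms(2) by simp
  finally show ?thesis .
qed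

text \<open>Jensen's inequality for the probability weight \<open>f\<^sup>2\<close>: \<open>E (f\<^sup>2 \<bar>f\<bar> powr (p - 2))\<close> is at least
  \<open>exp (- (2 - p) E (f\<^sup>2 ln \<bar>f\<bar>))\<close>. The proof uses the tangent of \<open>exp\<close> at \<open>- (2 - p) / 2\<close>.\<close>

lemma rsum_moment_ge:
  assumes "finite A" "(\<Sum>j\<in>A. (a j)\<^sup>2) = 1" "p \<le> 2"
  shows "exp (- ((2 - p) / 2)) \<le> rmean A (\<lambda>S. \<bar>rsum a A S\<bar> powr p)"
proof -
  let ?c = "exp (- ((2 - p) / 2))"
  let ?f = "rsum a A"
  have "?c * ((1 + (2 - p) / 2) * (?f S)\<^sup>2 - (2 - p) * ((?f S)\<^sup>2 * ln \<bar>?f S\<bar>)) \<le> \<bar>?f S\<bar> powr p" for S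
  proof (cases "?f S = 0")
    case False
    let ?t = "\<bar>?f S\<bar>"
    have "?c * (1 + ((2 - p) / 2 - (2 - p) * ln ?t)) \<le> ?c * exp ((2 - p) / 2 - (2 - p) * ln ?t)"
      by (intro mult_left_mono exp_ge_add_one_self) simp
    also have "\<dots> = ?t powr (p - 2)"
      using False by (simp add: powr_def exp_add [symmetric] algebra_simps)
    finally have "?t\<^sup>2 * (?c * (1 + ((2 - p) / 2 - (2 - p) * ln ?t))) \<le> ?t\<^sup>2 * ?t powr (p - 2)"
      by (rule mult_left_mono) simp
    also have "?t\<^sup>2 * ?t powr (p - 2) = ?t powr p"
      using False by (simp add: powr_diff powr_numeral)
    finally show ?thesis by (simp add: algebra_simps)
  qed simp
  then have "rmean A (\<lambda>S. ?c * ((1 + (2 - p) / 2) * (?f S)\<^sup>2 - (2 - p) * ((?f S)\<^sup>2 * ln \<bar>?f S\<bar>)))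
      \<le> rmean A (\<lambda>S. \<bar>?f S\<bar> powr p)"
    by (intro rmean_mono) auto
  then have "?c * ((1 + (2 - p) / 2) - (2 - p) * rmean A (\<lambda>S. (?f S)\<^sup>2 * ln \<bar>?f S\<bar>))
      \<le> rmean A (\<lambda>S. \<bar>?f S\<bar> powr p)"
    by (simp only: rmean_linear rsum_second_moment [OF assms(1)] assms(2) mult_1_right)
  moreover have "1 \<le> (1 + (2 - p) / 2) - (2 - p) * rmean A (\<lambda>S. (?f S)\<^sup>2 * ln \<bar>?f S\<bar>)"
    using mult_left_mono [OF rsum_entropy_le [OF assms(1,2)], of "2 - p"] assms(3) by simp
  then have "?c * 1 \<le> ?c * ((1 + (2 - p) / 2) - (2 - p) * rmean A (\<lambda>S. (?f S)\<^sup>2 * ln \<bar>?f S\<bar>))"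
    by (rule mult_left_mono) simp
  ultimately show ?thesis by linarith
qed

lemma khinchine:
  assumes "finite A" "0 < p" "p \<le> 2"
  shows "(\<Sum>j\<in>A. (a j)\<^sup>2) powr (p / 2) \<le> exp ((2 - p) / 2) * rmean A (\<lambda>S. \<bar>rsum a A S\<bar> powr p)"
proof -
  define s where "s = sqrt (\<Sum>j\<in>A. (a j)\<^sup>2)"
  have s_nonneg: "0 \<le> s" by (simp add: s_def sum_nonneg)
  have s2: "(\<Sum>j\<in>A. (a j)\<^sup>2) = s\<^sup>2" by (simp add: s_def sum_nonneg)
  have lhs: "(\<Sum>j\<in>A. (a j)\<^sup>2) powr (p / 2) = s powr p"
    using s_nonneg by (simp add: s_def powr_half_sqrt [symmetric] powr_powr sum_nonneg)
  show ?thesis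
  proof (cases "s = 0")
    case True
    then show ?thesis
      unfolding lhs by (auto intro!: mult_nonneg_nonneg rmean_nonneg)
  next
    case False
    with s_nonneg have s: "s > 0" by simp
    have "(\<Sum>j\<in>A. (a j / s)\<^sup>2) = 1"
      using s by (simp add: power_divide sum_divide_distrib [symmetric] s2)
    then have "exp (- ((2 - p) / 2)) \<le> rmean A (\<lambda>S. \<bar>rsum (\<lambda>j. a j / s) A S\<bar> powr p)"
      by (rule rsum_moment_ge [OF assms(1) _ assms(3)])
    also have "\<dots> = rmean A (\<lambda>S. \<bar>rsum a A S\<bar> powr p) / s powr p"
      using s by (simp add: rsum_def sum_divide_distrib [symmetric] powr_divide rmean_divide)
    finally show ?thesis
      unfolding lhs using s by (simp add: exp_minus field_simps)
  qed
qed

section \<open>The inequalities of Loomis--Whitney and Blei\<close>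

lemma weighted_arith_geom_mean2:
  fixes a b :: real
  assumes "0 \<le> \<alpha>" "0 \<le> \<beta>" "\<alpha> + \<beta> = 1" "0 \<le> a" "0 \<le> b"
  shows "a powr \<alpha> * b powr \<beta> \<le> \<alpha> * a + \<beta> * b"
  using assms Youngs_inequality_0 [of \<alpha> \<beta> a b] by (cases "a = 0 \<or> b = 0") auto

lemma sum_PiE_insert:
  assumes "x \<notin> L"
  shows "(\<Sum>g\<in>insert x L \<rightarrow>\<^sub>E J. f g) = (\<Sum>s\<in>J. \<Sum>g\<in>L \<rightarrow>\<^sub>E J. f (g(x := s)))"
  unfolding PiE_insert_eq sum.reindex [OF inj_combinator [OF assms, of "\<lambda>_. J"]] sum.cartesian_product
  by (simp add: case_prod_unfold)

lemma sum_PiE_remove: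
  assumes "k \<in> K"
  shows "(\<Sum>g\<in>K \<rightarrow>\<^sub>E J. f g) = (\<Sum>h\<in>K - {k} \<rightarrow>\<^sub>E J. \<Sum>s\<in>J. f (h(k := s)))"
  using sum_PiE_insert [where x = k and L = "K - {k}" and J = J and f = f] assms
  by (simp add: insert_absorb sum.swap [of _ J])

lemma restrict_remove_mem: "g \<in> L \<rightarrow>\<^sub>E J \<Longrightarrow> restrict g (L - {k}) \<in> L - {k} \<rightarrow>\<^sub>E J"
  by (simp add: PiE_iff)

lemma restrict_upd_remove:
  assumes "h \<in> K - {k} \<rightarrow>\<^sub>E J"
  shows "restrict (h(k := s)) (K - {k}) = h"
  using assms by (auto simp: fun_eq_iff restrict_def PiE_def extensional_def)

text \<open>Weighted arithmetic-geometric mean of \<open>F\<close> and \<open>\<Prod>k\<in>L. f k powr (1 / (m - 1))\<close>. For \<open>m = 1\<close> the second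
  weight is \<open>0\<close> and the exponent \<open>1 / (m - 1)\<close> is meaningless; then \<open>f k \<le> 1\<close> is used instead.\<close>

lemma loomis_whitney_fibre:
  assumes "finite L" "L \<noteq> {}"
    and F: "0 \<le> F"
    and f: "\<And>k. k \<in> L \<Longrightarrow> 0 \<le> f k" "\<And>k. k \<in> L \<Longrightarrow> card L = 1 \<Longrightarrow> f k \<le> 1"
  defines "m \<equiv> real (card L)"
  shows "F powr (1 / m) * (\<Prod>k\<in>L. f k powr (1 / m)) \<le>
    F / m + (m - 1) / m * (\<Prod>k\<in>L. f k powr (1 / (m - 1)))"
proof (cases "card L = 1")
  case True
  then obtain y where "L = {y}" by (rule card_1_singletonE)
  then show ?thesis
    using f F by (simp add: m_def mult_left_le)
next
  case False
  have m: "m > 1"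
    using False assms(1,2) by (simp add: m_def Suc_lessI card_gt_0_iff)
  have "(\<Prod>k\<in>L. f k powr (1 / m)) = (\<Prod>k\<in>L. f k powr (1 / (m - 1))) powr ((m - 1) / m)"
    using m by (simp add: prod_powr_distrib powr_powr)
  then show ?thesis
    using weighted_arith_geom_mean2 [of "1 / m" "(m - 1) / m" F "\<Prod>k\<in>L. f k powr (1 / (m - 1))"] m F f
    by (simp add: prod_nonneg diff_divide_distrib)
qed

text \<open>Induction on the set of slots. On the fibre over a value \<open>s\<close> of the new slot \<open>x\<close>, each \<open>F k\<close> with
  \<open>k \<noteq> x\<close> is its marginal \<open>G k s\<close> times a conditional density \<open>f k s\<close>; the induction hypothesis applies
  to the conditional densities, and the geometric mean of the marginals is at most their arithmetic
  mean.\<close>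

lemma loomis_whitney:
  fixes F :: "'k \<Rightarrow> ('k \<Rightarrow> 'j) \<Rightarrow> real"
  assumes "finite K" "finite J" "2 \<le> card K"
    and "\<And>k h. k \<in> K \<Longrightarrow> 0 \<le> F k h"
    and "\<And>k. k \<in> K \<Longrightarrow> (\<Sum>h\<in>K - {k} \<rightarrow>\<^sub>E J. F k h) \<le> 1"
  shows "(\<Sum>g\<in>K \<rightarrow>\<^sub>E J. \<Prod>k\<in>K. F k (restrict g (K - {k})) powr (1 / (real (card K) - 1))) \<le> 1"
  using assms
proof (induction K arbitrary: F rule: finite_induct)
  case empty
  then show ?case by simp
next
  case (insert x L)
  note nonneg = insert.prems(3) and le1 = insert.prems(4)
  define m where "m = real (card L)"
  have card_eq: "real (card (insert x L)) - 1 = m" using insert.hyps by (simp add: m_def)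
  have L: "L \<noteq> {}" using insert.prems(2) by auto
  have m: "m \<ge> 1" using insert.hyps(1) L by (simp add: m_def Suc_leI card_gt_0_iff)
  define G where "G k s = (\<Sum>h\<in>L - {k} \<rightarrow>\<^sub>E J. F k (h(x := s)))" for k s
  define f where "f k s h = F k (h(x := s)) / G k s" for k s h
  have G_nonneg: "0 \<le> G k s" if "k \<in> L" for k s
    unfolding G_def using that by (intro sum_nonneg nonneg) auto
  have f_nonneg: "0 \<le> f k s h" if "k \<in> L" for k s h
    unfolding f_def using that by (intro divide_nonneg_nonneg nonneg G_nonneg) auto
  have f_le1: "(\<Sum>h\<in>L - {k} \<rightarrow>\<^sub>E J. f k s h) \<le> 1" for k s
    by (simp add: f_def sum_divide_distrib [symmetric] G_def [symmetric])
  have factor: "F k (h(x := s)) = G k s * f k s h" if "k \<in> L" "h \<in> L - {k} \<rightarrow>\<^sub>E J" for k s h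
  proof (cases "G k s = 0")
    case True
    then have "F k (h(x := s)) = 0"
      unfolding G_def using that nonneg insert.hyps(1) \<open>finite J\<close>
      by (subst (asm) sum_nonneg_eq_0_iff) (auto intro!: finite_PiE)
    then show ?thesis using True by simp
  qed (simp add: f_def)
  have marginal: "(\<Sum>s\<in>J. G k s) \<le> 1" if "k \<in> L" for k
  proof -
    have "insert x L - {k} = insert x (L - {k})" using that insert.hyps(2) by auto
    then show ?thesis
      using le1 [of k] that insert.hyps(2) by (simp add: sum_PiE_insert G_def)
  qed
  have fibre: "(\<Sum>g\<in>L \<rightarrow>\<^sub>E J. F x g powr (1 / m) * (\<Prod>k\<in>L. f k s (restrict g (L - {k})) powr (1 / m))) \<le> 1"
    (is "?S \<le> 1") for s
  proof -
    let ?P = "\<lambda>g. \<Prod>k\<in>L. f k s (restrict g (L - {k})) powr (1 / (m - 1))"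
    have "?S \<le> (\<Sum>g\<in>L \<rightarrow>\<^sub>E J. F x g / m + (m - 1) / m * ?P g)"
    proof (rule sum_mono)
      fix g assume g: "g \<in> L \<rightarrow>\<^sub>E J"
      have "f k s (restrict g (L - {k})) \<le> 1" if k: "k \<in> L" for k
      proof -
        have "restrict g (L - {k}) \<in> L - {k} \<rightarrow>\<^sub>E J" using g by (rule restrict_remove_mem)
        then have "f k s (restrict g (L - {k})) \<le> (\<Sum>h\<in>L - {k} \<rightarrow>\<^sub>E J. f k s h)"
          by (rule member_le_sum) (use insert.hyps(1) \<open>finite J\<close> f_nonneg k in \<open>auto intro!: finite_PiE\<close>)
        then show ?thesis using f_le1 [of k s] by linarith
      qed
      then show "F x g powr (1 / m) * (\<Prod>k\<in>L. f k s (restrict g (L - {k})) powr (1 / m)) \<le>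
          F x g / m + (m - 1) / m * ?P g"
        unfolding m_def using insert.hyps(1) L nonneg f_nonneg
        by (intro loomis_whitney_fibre) auto
    qed
    also have "\<dots> = (\<Sum>g\<in>L \<rightarrow>\<^sub>E J. F x g) / m + (m - 1) / m * (\<Sum>g\<in>L \<rightarrow>\<^sub>E J. ?P g)"
      by (simp add: sum.distrib sum_divide_distrib sum_distrib_left)
    also have "\<dots> \<le> 1 / m + (m - 1) / m * 1"
    proof (intro add_mono divide_right_mono)
      show "(\<Sum>g\<in>L \<rightarrow>\<^sub>E J. F x g) \<le> 1" using le1 [of x] insert.hyps(2) by simp
      show "(m - 1) / m * (\<Sum>g\<in>L \<rightarrow>\<^sub>E J. ?P g) \<le> (m - 1) / m * 1"
      proof (cases "m = 1")
        case False
        then have card: "2 \<le> card L" using m by (simp add: m_def)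
        have "(\<Sum>g\<in>L \<rightarrow>\<^sub>E J. ?P g) \<le> 1"
          unfolding m_def by (rule insert.IH) (use card \<open>finite J\<close> f_nonneg f_le1 in auto)
        then show ?thesis using m by (intro mult_left_mono) auto
      qed simp
    qed (use m in auto)
    also have "\<dots> = 1" using m by (simp add: field_simps)
    finally show ?thesis .
  qed
  have "(\<Sum>g\<in>insert x L \<rightarrow>\<^sub>E J. \<Prod>k\<in>insert x L. F k (restrict g (insert x L - {k})) powr (1 / m)) =
      (\<Sum>s\<in>J. \<Sum>g\<in>L \<rightarrow>\<^sub>E J. F x g powr (1 / m) *
        (\<Prod>k\<in>L. (G k s * f k s (restrict g (L - {k}))) powr (1 / m)))"
    unfolding sum_PiE_insert [OF insert.hyps(2)]
  proof (intro sum.cong refl)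
    fix s g assume g: "g \<in> L \<rightarrow>\<^sub>E J"
    have "restrict (g(x := s)) (insert x L - {x}) = g"
      using g insert.hyps(2) by (auto simp: fun_eq_iff restrict_def PiE_def extensional_def)
    moreover have "F k (restrict (g(x := s)) (insert x L - {k})) = G k s * f k s (restrict g (L - {k}))"
      if "k \<in> L" for k
    proof -
      have "restrict (g(x := s)) (insert x L - {k}) = (restrict g (L - {k}))(x := s)"
        using that insert.hyps(2) by (auto simp: fun_eq_iff restrict_def)
      then show ?thesis using factor [OF that, of "restrict g (L - {k})" s] restrict_remove_mem [OF g] by simp
    qed
    ultimately show "(\<Prod>k\<in>insert x L. F k (restrict (g(x := s)) (insert x L - {k})) powr (1 / m)) =
        F x g powr (1 / m) * (\<Prod>k\<in>L. (G k s * f k s (restrict g (L - {k}))) powr (1 / m))"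
      using insert.hyps by simp
  qed
  also have "\<dots> = (\<Sum>s\<in>J. (\<Prod>k\<in>L. G k s powr (1 / m)) *
      (\<Sum>g\<in>L \<rightarrow>\<^sub>E J. F x g powr (1 / m) * (\<Prod>k\<in>L. f k s (restrict g (L - {k})) powr (1 / m))))"
    by (simp add: powr_mult prod.distrib sum_distrib_left mult_ac)
  also have "\<dots> \<le> (\<Sum>s\<in>J. (\<Prod>k\<in>L. G k s powr (1 / m)) * 1)"
    by (intro sum_mono mult_left_mono fibre prod_nonneg) auto
  also have "\<dots> \<le> (\<Sum>s\<in>J. \<Sum>k\<in>L. G k s / m)"
    unfolding m_def mult_1_right prod_powr_distrib [symmetric]
    using arith_geom_mean [OF insert.hyps(1) L] G_nonneg
    by (intro sum_mono) (simp add: prod_powr_distrib)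
  also have "\<dots> = (\<Sum>k\<in>L. (\<Sum>s\<in>J. G k s) / m)"
    by (simp add: sum.swap [of _ J] sum_divide_distrib)
  also have "\<dots> \<le> (\<Sum>k\<in>L. 1 / m)"
    using marginal m by (intro sum_mono divide_right_mono) auto
  also have "\<dots> = 1" using m by (simp add: m_def)
  finally show ?case
    by (simp only: card_eq)
qed

text \<open>Blei's inequality: control of all mixed norms with exponent \<open>2\<close> in one slot and \<open>2 (n - 1) / n\<close> in
  the others controls the norm of exponent \<open>2 n / (n + 1)\<close>. Pointwise, \<open>\<bar>b\<bar> powr (2 n / (n + 1))\<close> is the
  geometric mean of \<open>n + 1\<close> functions that each have sum at most \<open>1\<close>: the Loomis--Whitney product \<open>P\<close>
  of the slot norms, and for each \<open>k\<close> the function \<open>W k\<close>, which spreads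
  the slot norm over the slot in proportion to \<open>b\<^sup>2\<close>.\<close>

lemma blei:
  fixes b :: "('k \<Rightarrow> 'j) \<Rightarrow> real"
  assumes K: "finite K" "2 \<le> card K" and J: "finite J"
  defines "n \<equiv> real (card K)"
  assumes mixed: "\<And>k. k \<in> K \<Longrightarrow>
      (\<Sum>h\<in>K - {k} \<rightarrow>\<^sub>E J. (\<Sum>s\<in>J. (b (h(k := s)))\<^sup>2) powr ((n - 1) / n)) \<le> 1"
  shows "(\<Sum>g\<in>K \<rightarrow>\<^sub>E J. \<bar>b g\<bar> powr (2 * n / (n + 1))) \<le> 1"
proof -
  have n: "n \<ge> 2" using K by (simp add: n_def)
  define Q where "Q k h = (\<Sum>s\<in>J. (b (h(k := s)))\<^sup>2)" for k h
  define T where "T k h = Q k h powr ((n - 1) / n)" for k h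
  define P where "P g = (\<Prod>k\<in>K. T k (restrict g (K - {k})) powr (1 / (n - 1)))" for g
  define W where "W k g = T k (restrict g (K - {k})) * (b g)\<^sup>2 / Q k (restrict g (K - {k}))" for k g
  have Q_nonneg: "0 \<le> Q k h" for k h
    by (simp add: Q_def sum_nonneg)
  have W_nonneg: "0 \<le> W k g" for k g
    by (simp add: W_def T_def Q_nonneg)
  have P_nonneg: "0 \<le> P g" for g
    unfolding P_def by (intro prod_nonneg) auto
  have P_sum: "(\<Sum>g\<in>K \<rightarrow>\<^sub>E J. P g) \<le> 1"
    unfolding P_def n_def
    by (rule loomis_whitney [OF K(1) J K(2)])
      (use mixed in \<open>simp_all add: T_def Q_def n_def\<close>)
  have W_sum: "(\<Sum>g\<in>K \<rightarrow>\<^sub>E J. W k g) \<le> 1" if k: "k \<in> K" for k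
  proof -
    have "(\<Sum>g\<in>K \<rightarrow>\<^sub>E J. W k g) = (\<Sum>h\<in>K - {k} \<rightarrow>\<^sub>E J. \<Sum>s\<in>J. T k h * (b (h(k := s)))\<^sup>2 / Q k h)"
      unfolding sum_PiE_remove [OF k] W_def
      by (intro sum.cong refl) (simp add: restrict_upd_remove)
    also have "\<dots> = (\<Sum>h\<in>K - {k} \<rightarrow>\<^sub>E J. T k h * Q k h / Q k h)"
      by (simp add: sum_divide_distrib [symmetric] sum_distrib_left [symmetric] Q_def)
    also have "\<dots> \<le> (\<Sum>h\<in>K - {k} \<rightarrow>\<^sub>E J. T k h)"
      by (intro sum_mono) (simp add: T_def)
    also have "\<dots> \<le> 1"
      using mixed [OF k] by (simp add: T_def Q_def)
    finally show ?thesis .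
  qed
  have pointwise: "\<bar>b g\<bar> powr (2 * n / (n + 1)) \<le> (P g + (\<Sum>k\<in>K. W k g)) / (n + 1)"
    if g: "g \<in> K \<rightarrow>\<^sub>E J" for g
  proof (cases "b g = 0")
    case True
    then show ?thesis using n by (simp add: P_nonneg W_nonneg sum_nonneg)
  next
    case False
    let ?Q = "\<lambda>k. Q k (restrict g (K - {k}))"
    have Q_pos: "0 < ?Q k" if k: "k \<in> K" for k
    proof -
      have *: "(restrict g (K - {k}))(k := g k) = g"
        using g k by (auto simp: fun_eq_iff restrict_def PiE_def extensional_def)
      have "(b ((restrict g (K - {k}))(k := g k)))\<^sup>2 \<le> ?Q k"
        unfolding Q_def using J g k by (intro member_le_sum) auto
      then have "(b g)\<^sup>2 \<le> ?Q k" by (simp only: *)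
      then show ?thesis using False by (smt (verit) zero_less_power2)
    qed
    have P: "P g = (\<Prod>k\<in>K. ?Q k powr (1 / n))"
      unfolding P_def T_def using n by (intro prod.cong) (auto simp: powr_powr)
    have W: "W k g = \<bar>b g\<bar> powr 2 * ?Q k powr (- (1 / n))" if "k \<in> K" for k
    proof -
      have "?Q k powr ((n - 1) / n) / ?Q k = ?Q k powr ((n - 1) / n - 1)"
        using Q_pos [OF that] by (simp add: powr_diff)
      moreover have "(n - 1) / n - 1 = - (1 / n)"
        using n by (simp add: field_simps)
      ultimately show ?thesis
        using False by (simp add: W_def T_def powr_numeral flip: times_divide_eq_left)
    qed
    let ?x = "\<lambda>i. case i of None \<Rightarrow> P g | Some k \<Rightarrow> W k g"
    let ?I = "insert None (Some ` K)"
    have "(\<Prod>i\<in>?I. ?x i) powr (1 / card ?I) \<le> (\<Sum>i\<in>?I. ?x i / card ?I)"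
      by (rule arith_geom_mean) (use K P_nonneg W_nonneg in auto)
    moreover have "real (card ?I) = n + 1"
      using K by (simp add: n_def card_image)
    ultimately have "(P g * (\<Prod>k\<in>K. W k g)) powr (1 / (n + 1)) \<le> (P g + (\<Sum>k\<in>K. W k g)) / (n + 1)"
      using K by (simp add: prod.reindex sum.reindex sum_divide_distrib [symmetric] add_divide_distrib add.commute)
    moreover have "P g * (\<Prod>k\<in>K. W k g) = \<bar>b g\<bar> powr (2 * n)"
    proof -
      have "(\<Prod>k\<in>K. W k g) = (\<bar>b g\<bar> powr 2) ^ card K * (\<Prod>k\<in>K. ?Q k powr (- (1 / n)))"
        by (simp add: W prod.distrib)
      moreover have "(\<Prod>k\<in>K. ?Q k powr (1 / n)) * (\<Prod>k\<in>K. ?Q k powr (- (1 / n))) = 1"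
        unfolding prod.distrib [symmetric]
        using Q_pos by (intro prod.neutral) (simp add: powr_add [symmetric] less_imp_neq [symmetric])
      moreover have "(\<bar>b g\<bar> powr 2) ^ card K = \<bar>b g\<bar> powr (2 * n)"
        using False by (subst powr_realpow [symmetric]) (simp, simp only: powr_powr n_def)
      ultimately show ?thesis by (simp add: P)
    qed
    ultimately show ?thesis by (simp add: powr_powr)
  qed
  have "(\<Sum>g\<in>K \<rightarrow>\<^sub>E J. \<bar>b g\<bar> powr (2 * n / (n + 1))) \<le>
      (\<Sum>g\<in>K \<rightarrow>\<^sub>E J. (P g + (\<Sum>k\<in>K. W k g)) / (n + 1))"
    by (rule sum_mono) (rule pointwise)
  also have "\<dots> = ((\<Sum>g\<in>K \<rightarrow>\<^sub>E J. P g) + (\<Sum>k\<in>K. \<Sum>g\<in>K \<rightarrow>\<^sub>E J. W k g)) / (n + 1)"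
    by (simp add: sum_divide_distrib [symmetric] sum.distrib sum.swap [of _ K])
  also have "\<dots> \<le> (1 + (\<Sum>k\<in>K. 1)) / (n + 1)"
    using n by (intro divide_right_mono add_mono P_sum sum_mono W_sum) auto
  also have "\<dots> = 1" using n by (simp add: n_def)
  finally show ?thesis .
qed

section \<open>Coefficient arrays bounded at sign vectors\<close>

definition BH_exponent :: "nat \<Rightarrow> real" where
  "BH_exponent n = 2 * real n / (real n + 1)"

text \<open>Evaluating the form with coefficients \<open>a\<close> at tuples of sign vectors is all that the induction needs;
  slots and coordinates range over arbitrary sets so that a slot can be removed.\<close>

definition sign_contractive :: "'k set \<Rightarrow> 'j set \<Rightarrow> (('k \<Rightarrow> 'j) \<Rightarrow> real) \<Rightarrow> bool" where
  "sign_contractive K J a \<longleftrightarrow> (\<forall>z. (\<forall>k j. \<bar>z k j\<bar> = 1) \<longrightarrow>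
     \<bar>\<Sum>g\<in>K \<rightarrow>\<^sub>E J. a g * (\<Prod>k\<in>K. z k (g k))\<bar> \<le> 1)"

text \<open>The normalised inequality: without the outer root, for forms of norm at most \<open>1\<close>.\<close>

definition BH_bound :: "'k set \<Rightarrow> 'j set \<Rightarrow> real \<Rightarrow> bool" where
  "BH_bound K J C \<longleftrightarrow> (\<forall>a. sign_contractive K J a \<longrightarrow>
     (\<Sum>g\<in>K \<rightarrow>\<^sub>E J. \<bar>a g\<bar> powr BH_exponent (card K)) \<le> C powr BH_exponent (card K))"

lemma abs_rsign [simp]: "\<bar>rsign S j\<bar> = 1"
  by (simp add: rsign_def)

lemma BH_bound_one:
  assumes "card K = 1"
  shows "BH_bound K J 1"
  unfolding BH_bound_def
proof (intro allI impI)
  fix a :: "('a \<Rightarrow> 'b) \<Rightarrow> real"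
  assume a: "sign_contractive K J a"
  obtain x where K: "K = {x}" using assms by (rule card_1_singletonE)
  (* The signs of the coefficients turn the form into their absolute sum. *)
  define z where "z k j = (if 0 \<le> a (restrict (\<lambda>_. j) K) then 1 else -1 :: real)" for k :: 'a and j
  have "\<bar>\<Sum>g\<in>K \<rightarrow>\<^sub>E J. a g * (\<Prod>k\<in>K. z k (g k))\<bar> \<le> 1"
    using a unfolding sign_contractive_def by (elim allE [of _ z]) (simp add: z_def)
  moreover have "a g * (\<Prod>k\<in>K. z k (g k)) = \<bar>a g\<bar>" if "g \<in> K \<rightarrow>\<^sub>E J" for g
  proof -
    have "restrict (\<lambda>_. g x) K = g"
      using that K by (auto simp: fun_eq_iff restrict_def PiE_def extensional_def)
    then show ?thesis by (simp add: K z_def)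
  qed
  ultimately show "(\<Sum>g\<in>K \<rightarrow>\<^sub>E J. \<bar>a g\<bar> powr BH_exponent (card K)) \<le> 1 powr BH_exponent (card K)"
    by (simp add: assms BH_exponent_def abs_of_nonneg sum_nonneg)
qed

lemma sign_contractive_slot:
  assumes K: "finite K" "k \<in> K" and a: "sign_contractive K J a"
  shows "sign_contractive (K - {k}) J (\<lambda>h. rsum (\<lambda>s. a (h(k := s))) J S)"
  unfolding sign_contractive_def
proof (intro allI impI)
  fix z :: "'a \<Rightarrow> 'b \<Rightarrow> real"
  assume z: "\<forall>k j. \<bar>z k j\<bar> = 1"
  define z' where "z' = z(k := rsign S)"
  have signs: "\<forall>l j. \<bar>z' l j\<bar> = 1" using z by (simp add: z'_def)
  have "(\<Sum>h\<in>K - {k} \<rightarrow>\<^sub>E J. rsum (\<lambda>s. a (h(k := s))) J S * (\<Prod>l\<in>K - {k}. z l (h l))) =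
      (\<Sum>h\<in>K - {k} \<rightarrow>\<^sub>E J. \<Sum>s\<in>J. a (h(k := s)) * (\<Prod>l\<in>K. z' l ((h(k := s)) l)))"
  proof (intro sum.cong refl)
    fix h
    have "(\<Prod>l\<in>K. z' l ((h(k := s)) l)) = rsign S s * (\<Prod>l\<in>K - {k}. z l (h l))" for s
    proof -
      have "(\<Prod>l\<in>K - {k}. z' l ((h(k := s)) l)) = (\<Prod>l\<in>K - {k}. z l (h l))"
        by (rule prod.cong) (auto simp: z'_def)
      then show ?thesis
        using K by (simp add: prod.remove [of K k] z'_def)
    qed
    then show "rsum (\<lambda>s. a (h(k := s))) J S * (\<Prod>l\<in>K - {k}. z l (h l)) =
        (\<Sum>s\<in>J. a (h(k := s)) * (\<Prod>l\<in>K. z' l ((h(k := s)) l)))"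
      by (simp add: rsum_def sum_distrib_right mult.assoc)
  qed
  also have "\<dots> = (\<Sum>g\<in>K \<rightarrow>\<^sub>E J. a g * (\<Prod>l\<in>K. z' l (g l)))"
    using sum_PiE_remove [OF K(2), where J = J and f = "\<lambda>g. a g * (\<Prod>l\<in>K. z' l (g l))"] by simp
  finally show "\<bar>\<Sum>h\<in>K - {k} \<rightarrow>\<^sub>E J. rsum (\<lambda>s. a (h(k := s))) J S * (\<Prod>l\<in>K - {k}. z l (h l))\<bar> \<le> 1"
    using a signs by (simp add: sign_contractive_def)
qed

text \<open>Random signs in slot \<open>k\<close> give a form on the other slots, to which the constant \<open>C\<close> applies with the
  exponent \<open>p\<close>. Averaging over the signs and using Khinchine's inequality bounds the mixed norm that
  belongs to \<open>k\<close> by \<open>\<kappa> C\<close>, and Blei's inequality combines these bounds.\<close>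

lemma BH_bound_step:
  fixes K :: "'k set" and J :: "'j set"
  assumes K: "finite K" "2 \<le> card K" and J: "finite J"
  defines "p \<equiv> BH_exponent (card K - 1)"
  assumes \<kappa>: "0 < \<kappa>" "\<And>a :: 'j \<Rightarrow> real. (\<Sum>j\<in>J. (a j)\<^sup>2) powr (p / 2) \<le>
      \<kappa> powr p * rmean J (\<lambda>S. \<bar>rsum a J S\<bar> powr p)"
    and C: "0 < C" "\<And>k. k \<in> K \<Longrightarrow> BH_bound (K - {k}) J C"
  shows "BH_bound K J (\<kappa> * C)"
  unfolding BH_bound_def
proof (intro allI impI)
  fix a :: "('k \<Rightarrow> 'j) \<Rightarrow> real"
  assume a: "sign_contractive K J a"
  define n where "n = real (card K)"
  have n: "n \<ge> 2" using K by (simp add: n_def)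
  have p: "p / 2 = (n - 1) / n" "p > 0"
    using K by (simp_all add: p_def BH_exponent_def n_def of_nat_diff divide_simps)
  define b where "b g = a g / (\<kappa> * C)" for g
  have "(\<Sum>h\<in>K - {k} \<rightarrow>\<^sub>E J. (\<Sum>s\<in>J. (b (h(k := s)))\<^sup>2) powr ((n - 1) / n)) \<le> 1"
    if k: "k \<in> K" for k
  proof -
    let ?f = "\<lambda>h. rsum (\<lambda>s. a (h(k := s))) J"
    have slot: "(\<Sum>h\<in>K - {k} \<rightarrow>\<^sub>E J. \<bar>?f h S\<bar> powr p) \<le> C powr p" for S
      using C(2) [OF k] sign_contractive_slot [OF K(1) k a, of S] K k
      by (simp add: BH_bound_def p_def)
    have "(\<Sum>h\<in>K - {k} \<rightarrow>\<^sub>E J. (\<Sum>s\<in>J. (a (h(k := s)))\<^sup>2) powr (p / 2)) \<le>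
        (\<Sum>h\<in>K - {k} \<rightarrow>\<^sub>E J. \<kappa> powr p * rmean J (\<lambda>S. \<bar>?f h S\<bar> powr p))"
      by (intro sum_mono \<kappa>(2))
    also have "\<dots> = \<kappa> powr p * rmean J (\<lambda>S. \<Sum>h\<in>K - {k} \<rightarrow>\<^sub>E J. \<bar>?f h S\<bar> powr p)"
      by (simp add: rmean_sum sum_distrib_left)
    also have "\<dots> \<le> \<kappa> powr p * rmean J (\<lambda>S. C powr p)"
      by (intro mult_left_mono rmean_mono slot) simp
    also have "\<dots> = (\<kappa> * C) powr p"
      using J by (simp add: rmean_const powr_mult)
    finally have *: "(\<Sum>h\<in>K - {k} \<rightarrow>\<^sub>E J. (\<Sum>s\<in>J. (a (h(k := s)))\<^sup>2) powr (p / 2)) \<le> (\<kappa> * C) powr p" .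
    have "(\<Sum>s\<in>J. (b (h(k := s)))\<^sup>2) powr (p / 2) =
        (\<Sum>s\<in>J. (a (h(k := s)))\<^sup>2) powr (p / 2) / (\<kappa> * C) powr p" for h
    proof -
      have "(\<Sum>s\<in>J. (b (h(k := s)))\<^sup>2) = (\<Sum>s\<in>J. (a (h(k := s)))\<^sup>2) / (\<kappa> * C) powr 2"
        using \<kappa>(1) C(1) by (simp add: b_def power_divide sum_divide_distrib)
      then show ?thesis
        using \<kappa>(1) C(1) by (simp add: powr_divide powr_powr sum_nonneg del: powr_numeral)
    qed
    then show ?thesis
      using * \<kappa>(1) C(1) by (simp add: p(1) [symmetric] sum_divide_distrib [symmetric])
  qed
  then have "(\<Sum>g\<in>K \<rightarrow>\<^sub>E J. \<bar>b g\<bar> powr (2 * n / (n + 1))) \<le> 1"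
    unfolding n_def by (rule blei [OF K J])
  moreover have "\<bar>b g\<bar> powr (2 * n / (n + 1)) = \<bar>a g\<bar> powr (2 * n / (n + 1)) / (\<kappa> * C) powr (2 * n / (n + 1))" for g
    using \<kappa>(1) C(1) by (simp add: b_def abs_mult powr_divide)
  ultimately show "(\<Sum>g\<in>K \<rightarrow>\<^sub>E J. \<bar>a g\<bar> powr BH_exponent (card K)) \<le>
      (\<kappa> * C) powr BH_exponent (card K)"
    using \<kappa>(1) C(1) by (simp add: BH_exponent_def n_def sum_divide_distrib [symmetric])
qed

text \<open>With \<open>p = 2 m / (m + 1)\<close> the constant of the general Khinchine inequality is \<open>exp (1 / (2 m))\<close>, and
  \<open>1 / m \<le> ln (m / (m - 1))\<close>. The weaker value \<open>sqrt (m / (m - 1))\<close> makes products telescope.\<close>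

lemma khinchine_BH_exponent:
  assumes "finite A" "2 \<le> m"
  defines "p \<equiv> BH_exponent m"
  shows "(\<Sum>j\<in>A. (a j)\<^sup>2) powr (p / 2) \<le>
    sqrt (real m / (real m - 1)) powr p * rmean A (\<lambda>S. \<bar>rsum a A S\<bar> powr p)"
proof -
  have p: "0 < p" "p \<le> 2" "(2 - p) / 2 = p / (2 * real m)"
    using assms(2) by (simp_all add: p_def BH_exponent_def divide_simps)
  have "1 / real m \<le> - ln (1 - 1 / real m)"
    using ln_le_minus_one [of "1 - 1 / real m"] assms(2) by simp
  also have "\<dots> = ln (real m / (real m - 1))"
  proof -
    have "1 - 1 / real m = inverse (real m / (real m - 1))"
      using assms(2) by (simp add: diff_divide_distrib)
    then show ?thesis
      using assms(2) by (simp only: ln_inverse)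
  qed
  finally have "p / 2 * (1 / real m) \<le> p / 2 * ln (real m / (real m - 1))"
    using p by (intro mult_left_mono) auto
  also have "p / 2 * (1 / real m) = (2 - p) / 2"
    by (simp add: p(3))
  also have "p / 2 * ln (real m / (real m - 1)) = p * ln (sqrt (real m / (real m - 1)))"
    using assms(2) by (subst ln_sqrt) auto
  finally have "exp ((2 - p) / 2) \<le> sqrt (real m / (real m - 1)) powr p"
    using assms(2) by (simp add: powr_def)
  then have "exp ((2 - p) / 2) * rmean A (\<lambda>S. \<bar>rsum a A S\<bar> powr p) \<le>
      sqrt (real m / (real m - 1)) powr p * rmean A (\<lambda>S. \<bar>rsum a A S\<bar> powr p)"
    by (intro mult_right_mono rmean_nonneg) auto
  then show ?thesis
    using khinchine [OF assms(1) p(1,2), of a] by linarith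
qed

text \<open>The Khinchine constants multiply up to
  \<open>sqrt 2 * sqrt (2 / 1) * sqrt (3 / 2) * \<dots> * sqrt ((n - 1) / (n - 2))\<close>.\<close>

theorem BH_bound_sqrt:
  fixes K :: "'k set" and J :: "'j set"
  assumes "finite K" "finite J" "2 \<le> card K"
  shows "BH_bound K J (sqrt (2 * (real (card K) - 1)))"
  using assms(3,1)
proof (induction "card K" arbitrary: K rule: nat_induct_at_least)
  case base
  have "BH_bound K J (sqrt 2 * 1)"
  proof (rule BH_bound_step)
    show "(\<Sum>j\<in>J. (a j)\<^sup>2) powr (BH_exponent (card K - 1) / 2) \<le>
        sqrt 2 powr BH_exponent (card K - 1) * rmean J (\<lambda>S. \<bar>rsum a J S\<bar> powr BH_exponent (card K - 1))"
      for a :: "'j \<Rightarrow> real"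
      using szarek [OF assms(2), of a] base(1) [symmetric]
      by (simp add: BH_exponent_def powr_half_sqrt sum_nonneg)
    show "BH_bound (K - {k}) J 1" if "k \<in> K" for k
      using that base by (intro BH_bound_one) simp
  qed (use base assms(2) in auto)
  then show ?case using base(1) [symmetric] by simp
next
  case (Suc n)
  define c where "c = sqrt (real n / (real n - 1))"
  have "BH_bound K J (c * sqrt (2 * (real n - 1)))"
  proof (rule BH_bound_step)
    show "(\<Sum>j\<in>J. (a j)\<^sup>2) powr (BH_exponent (card K - 1) / 2) \<le>
        c powr BH_exponent (card K - 1) * rmean J (\<lambda>S. \<bar>rsum a J S\<bar> powr BH_exponent (card K - 1))"
      for a :: "'j \<Rightarrow> real"
      using khinchine_BH_exponent [OF assms(2) Suc.hyps(1), of a] Suc.hyps(3) [symmetric]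
      by (simp add: c_def)
    show "BH_bound (K - {k}) J (sqrt (2 * (real n - 1)))" if "k \<in> K" for k
    proof -
      have "card (K - {k}) = n" using that Suc by simp
      then show ?thesis using Suc.hyps(2) [of "K - {k}"] Suc.prems by simp
    qed
  qed (use Suc assms(2) in \<open>auto simp: c_def\<close>)
  moreover have "c * sqrt (2 * (real n - 1)) = sqrt (2 * (real (card K) - 1))"
    using Suc.hyps(1) Suc.hyps(3) [symmetric]
    by (simp add: c_def real_sqrt_mult [symmetric] del: real_sqrt_eq_iff)
      (simp add: divide_simps algebra_simps)
  ultimately show ?case by simp
qed

section \<open>Multilinear forms on real vectors\<close>

definition tuple :: "nat \<Rightarrow> nat \<Rightarrow> (nat \<Rightarrow> nat \<Rightarrow> real) \<Rightarrow> nat \<Rightarrow> nat \<Rightarrow> real" where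
  "tuple n N z = (\<lambda>k\<in>{1..n}. \<lambda>j\<in>{1..N}. z k j)"

definition form_coeff :: "nat \<Rightarrow> nat \<Rightarrow> ((nat \<Rightarrow> nat \<Rightarrow> real) \<Rightarrow> real) \<Rightarrow> (nat \<Rightarrow> nat) \<Rightarrow> real" where
  "form_coeff n N U i = U (\<lambda>k\<in>{1..n}. canonical_vec N (i k))"

(* Intervals are written {1..n}; rewriting 1 to Suc 0 would hide them from the rules below. *)
declare One_nat_def [simp del]

lemma restrict_mem_rvecs [simp]: "restrict x {1..N} \<in> rvecs N"
  by (simp add: rvecs_def)

lemma canonical_vec_mem_rvecs [simp]: "canonical_vec N i \<in> rvecs N"
  by (simp add: canonical_vec_def)

lemma multilinear_form_slot:
  assumes U: "multilinear_form n N U" and w: "w \<in> {1..n} \<rightarrow>\<^sub>E rvecs N" and k: "k \<in> {1..n}"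
  shows "U (w(k := restrict y {1..N})) = (\<Sum>j\<in>{1..N}. y j * U (w(k := canonical_vec N j)))"
proof -
  have linear: "U (w(k := lincomb N a x b x')) = a * U (w(k := x)) + b * U (w(k := x'))"
    if "x \<in> rvecs N" "x' \<in> rvecs N" for a b x x'
    using U w k that unfolding multilinear_form_def by blast
  have "U (w(k := (\<lambda>j\<in>{1..N}. if j \<in> B then y j else 0))) =
      (\<Sum>j\<in>B. y j * U (w(k := canonical_vec N j)))" if "finite B" "B \<subseteq> {1..N}" for B
    using that
  proof (induction B rule: finite_induct)
    case empty
    let ?o = "\<lambda>j\<in>{1..N}. 0 :: real"
    have "U (w(k := lincomb N 0 ?o 0 ?o)) = 0"
      using linear [of ?o ?o 0 0] by simp
    moreover have "(\<lambda>j\<in>{1..N}. if j \<in> {} then y j else 0) = lincomb N 0 ?o 0 ?o"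
      by (simp add: lincomb_def)
    ultimately show ?case by (simp only: sum.empty)
  next
    case (insert b B)
    have "(\<lambda>j\<in>{1..N}. if j \<in> insert b B then y j else 0) =
        lincomb N 1 (\<lambda>j\<in>{1..N}. if j \<in> B then y j else 0) (y b) (canonical_vec N b)"
      using insert.hyps by (auto simp: lincomb_def canonical_vec_def fun_eq_iff)
    moreover have "U (w(k := lincomb N 1 (\<lambda>j\<in>{1..N}. if j \<in> B then y j else 0) (y b) (canonical_vec N b))) =
        1 * U (w(k := (\<lambda>j\<in>{1..N}. if j \<in> B then y j else 0))) + y b * U (w(k := canonical_vec N b))"
      by (rule linear) simp_all
    moreover have "U (w(k := (\<lambda>j\<in>{1..N}. if j \<in> B then y j else 0))) =
        (\<Sum>j\<in>B. y j * U (w(k := canonical_vec N j)))"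
      by (rule insert.IH) (use insert.prems in auto)
    ultimately show ?case
      unfolding sum.insert [OF insert.hyps] by (simp only: add.commute mult_1_left)
  qed
  from this [of "{1..N}"] have "U (w(k := (\<lambda>j\<in>{1..N}. if j \<in> {1..N} then y j else 0))) =
      (\<Sum>j\<in>{1..N}. y j * U (w(k := canonical_vec N j)))" by simp
  moreover have "(\<lambda>j\<in>{1..N}. if j \<in> {1..N} then y j else 0) = restrict y {1..N}"
    by (auto simp: fun_eq_iff)
  ultimately show ?thesis by simp
qed

text \<open>Expanding only the slots in \<open>A\<close> and keeping arbitrary vectors \<open>w\<close> in the others makes an induction on
  \<open>A\<close> possible.\<close>

lemma multilinear_form_partial_expansion:
  assumes U: "multilinear_form n N U" and "finite A" "A \<subseteq> {1..n}"
    and "w \<in> {1..n} \<rightarrow>\<^sub>E rvecs N"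
  shows "U (\<lambda>k. if k \<in> A then restrict (z k) {1..N} else w k) =
    (\<Sum>i\<in>A \<rightarrow>\<^sub>E {1..N}. (\<Prod>k\<in>A. z k (i k)) *
      U (\<lambda>k. if k \<in> A then canonical_vec N (i k) else w k))"
  using assms(2-)
proof (induction A arbitrary: w rule: finite_induct)
  case empty
  then show ?case by simp
next
  case (insert x A)
  let ?w = "w(x := restrict (z x) {1..N})"
  have x: "x \<in> {1..n}" and A: "A \<subseteq> {1..n}" using insert.prems by auto
  have w: "?w \<in> {1..n} \<rightarrow>\<^sub>E rvecs N"
    using insert.prems x by (auto simp: PiE_def extensional_def)
  have "(\<lambda>k. if k \<in> insert x A then restrict (z k) {1..N} else w k) =
      (\<lambda>k. if k \<in> A then restrict (z k) {1..N} else ?w k)"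
    using insert.hyps by (auto simp: fun_eq_iff)
  then have "U (\<lambda>k. if k \<in> insert x A then restrict (z k) {1..N} else w k) =
      (\<Sum>i\<in>A \<rightarrow>\<^sub>E {1..N}. (\<Prod>k\<in>A. z k (i k)) *
        U (\<lambda>k. if k \<in> A then canonical_vec N (i k) else ?w k))"
    by (simp only: insert.IH [OF A w])
  also have "\<dots> = (\<Sum>i\<in>A \<rightarrow>\<^sub>E {1..N}. \<Sum>j\<in>{1..N}. (\<Prod>k\<in>insert x A. z k ((i(x := j)) k)) *
        U (\<lambda>k. if k \<in> insert x A then canonical_vec N ((i(x := j)) k) else w k))"
  proof (intro sum.cong refl)
    fix i assume i: "i \<in> A \<rightarrow>\<^sub>E {1..N}"
    define v where "v = (\<lambda>k. if k \<in> A then canonical_vec N (i k) else w k)"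
    have v: "v \<in> {1..n} \<rightarrow>\<^sub>E rvecs N"
      using insert.prems A by (auto simp: v_def PiE_def extensional_def)
    have "(\<lambda>k. if k \<in> A then canonical_vec N (i k) else ?w k) = v(x := restrict (z x) {1..N})"
      using insert.hyps by (auto simp: v_def fun_eq_iff)
    then have "U (\<lambda>k. if k \<in> A then canonical_vec N (i k) else ?w k) =
        (\<Sum>j\<in>{1..N}. z x j * U (v(x := canonical_vec N j)))"
      by (simp only: multilinear_form_slot [OF U v x])
    moreover have "v(x := canonical_vec N j) =
        (\<lambda>k. if k \<in> insert x A then canonical_vec N ((i(x := j)) k) else w k)" for j
      using insert.hyps by (auto simp: v_def fun_eq_iff)
    moreover have "(\<Prod>k\<in>insert x A. z k ((i(x := j)) k)) = z x j * (\<Prod>k\<in>A. z k (i k))" for j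
    proof -
      have "(\<Prod>k\<in>A. z k ((i(x := j)) k)) = (\<Prod>k\<in>A. z k (i k))"
        using insert.hyps by (intro prod.cong) auto
      then show ?thesis using insert.hyps by simp
    qed
    ultimately show "(\<Prod>k\<in>A. z k (i k)) * U (\<lambda>k. if k \<in> A then canonical_vec N (i k) else ?w k) =
        (\<Sum>j\<in>{1..N}. (\<Prod>k\<in>insert x A. z k ((i(x := j)) k)) *
          U (\<lambda>k. if k \<in> insert x A then canonical_vec N ((i(x := j)) k) else w k))"
      by (simp only: sum_distrib_left mult_ac)
  qed
  also have "\<dots> = (\<Sum>j\<in>{1..N}. \<Sum>i\<in>A \<rightarrow>\<^sub>E {1..N}. (\<Prod>k\<in>insert x A. z k ((i(x := j)) k)) *
        U (\<lambda>k. if k \<in> insert x A then canonical_vec N ((i(x := j)) k) else w k))"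
    by (rule sum.swap)
  also have "\<dots> = (\<Sum>i\<in>insert x A \<rightarrow>\<^sub>E {1..N}. (\<Prod>k\<in>insert x A. z k (i k)) *
        U (\<lambda>k. if k \<in> insert x A then canonical_vec N (i k) else w k))"
    by (rule sum_PiE_insert [OF insert.hyps(2), symmetric])
  finally show ?case .
qed

lemma multilinear_form_expansion:
  assumes "multilinear_form n N U"
  shows "U (tuple n N z) = (\<Sum>i\<in>{1..n} \<rightarrow>\<^sub>E {1..N}. form_coeff n N U i * (\<Prod>k\<in>{1..n}. z k (i k)))"
proof -
  let ?w = "\<lambda>k\<in>{1..n}. canonical_vec N 1"
  have "?w \<in> {1..n} \<rightarrow>\<^sub>E rvecs N" by simp
  note expansion = multilinear_form_partial_expansion [OF assms finite_atLeastAtMost subset_refl this, of z]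
  have "(\<lambda>k. if k \<in> {1..n} then restrict (z k) {1..N} else ?w k) = tuple n N z"
    by (auto simp: tuple_def fun_eq_iff)
  moreover have "(\<lambda>k. if k \<in> {1..n} then canonical_vec N (i k) else ?w k) =
      (\<lambda>k\<in>{1..n}. canonical_vec N (i k))" for i
    by (auto simp: fun_eq_iff)
  ultimately show ?thesis
    using expansion by (simp only: form_coeff_def mult.commute)
qed

lemma sup_ball_iff:
  assumes "N \<ge> 1"
  shows "x \<in> sup_ball N \<longleftrightarrow> x \<in> rvecs N \<and> (\<forall>j\<in>{1..N}. \<bar>x j\<bar> < 1)"
  using assms by (auto simp: sup_ball_def sup_norm_def)

lemma form_norm_upper:
  assumes U: "multilinear_form n N U" and N: "N \<ge> 1"
    and z: "\<And>k j. k \<in> {1..n} \<Longrightarrow> j \<in> {1..N} \<Longrightarrow> \<bar>z k j\<bar> < 1"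
  shows "\<bar>U (tuple n N z)\<bar> \<le> form_norm n N U"
  unfolding form_norm_def
proof (rule cSUP_upper)
  show "tuple n N z \<in> {1..n} \<rightarrow>\<^sub>E sup_ball N"
    using z N by (auto simp: tuple_def sup_ball_iff)
  show "bdd_above ((\<lambda>z. \<bar>U z\<bar>) ` ({1..n} \<rightarrow>\<^sub>E sup_ball N))"
  proof (rule bdd_aboveI2)
    fix v assume v: "v \<in> {1..n} \<rightarrow>\<^sub>E sup_ball N"
    have "tuple n N v = v"
      using v N
      by (auto simp: tuple_def fun_eq_iff restrict_def PiE_def Pi_def extensional_def sup_ball_iff rvecs_def)
    have "\<bar>U v\<bar> = \<bar>\<Sum>i\<in>{1..n} \<rightarrow>\<^sub>E {1..N}. form_coeff n N U i * (\<Prod>k\<in>{1..n}. v k (i k))\<bar>"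
      using multilinear_form_expansion [OF U, of v] \<open>tuple n N v = v\<close> by simp
    also have "\<dots> \<le> (\<Sum>i\<in>{1..n} \<rightarrow>\<^sub>E {1..N}. \<bar>form_coeff n N U i * (\<Prod>k\<in>{1..n}. v k (i k))\<bar>)"
      by (rule sum_abs)
    also have "\<dots> \<le> (\<Sum>i\<in>{1..n} \<rightarrow>\<^sub>E {1..N}. \<bar>form_coeff n N U i\<bar> * 1)"
      unfolding abs_mult abs_prod
    proof (intro sum_mono mult_left_mono prod_le_1)
      fix i k assume i: "i \<in> {1..n} \<rightarrow>\<^sub>E {1..N}" and k: "k \<in> {1..n}"
      have "i k \<in> {1..N}" using i k by (rule PiE_mem)
      moreover have "v k \<in> sup_ball N" using v k by (rule PiE_mem)
      ultimately show "0 \<le> \<bar>v k (i k)\<bar> \<and> \<bar>v k (i k)\<bar> \<le> 1"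
        using N by (auto simp: sup_ball_iff less_imp_le)
    qed simp
    finally show "\<bar>U v\<bar> \<le> (\<Sum>i\<in>{1..n} \<rightarrow>\<^sub>E {1..N}. \<bar>form_coeff n N U i\<bar> * 1)" .
  qed
qed

text \<open>Sign vectors lie on the boundary of the open ball, so they are approached by \<open>r\<close> times them, and the
  form scales by \<open>r ^ n\<close>.\<close>

lemma form_norm_upper_signs:
  assumes U: "multilinear_form n N U" and "n \<ge> 1" "N \<ge> 1" and z: "\<And>k j. \<bar>z k j\<bar> = 1"
  shows "\<bar>U (tuple n N z)\<bar> \<le> form_norm n N U"
proof (rule field_le_mult_one_interval)
  fix t :: real assume t: "0 < t" "t < 1"
  define r where "r = root n t"
  have r: "0 < r" "r < 1" "r ^ n = t"
    using t assms(2) by (simp_all add: r_def)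
  have "U (tuple n N (\<lambda>k j. r * z k j)) = t * U (tuple n N z)"
    unfolding multilinear_form_expansion [OF U]
    by (simp add: prod.distrib r(3) sum_distrib_left mult_ac)
  moreover have "\<bar>U (tuple n N (\<lambda>k j. r * z k j))\<bar> \<le> form_norm n N U"
    using r z by (intro form_norm_upper U assms) (simp add: abs_mult)
  ultimately show "t * \<bar>U (tuple n N z)\<bar> \<le> form_norm n N U"
    using t by (simp add: abs_mult)
qed

text \<open>The form is divided by a number slightly above its norm, because the norm may be \<open>0\<close>.\<close>

lemma BH_bound_imp_multilinear:
  assumes BH: "BH_bound {1..n} {1..N} C" and C: "C > 0"
    and U: "multilinear_form n N U" and "n \<ge> 1" "N \<ge> 1"
  defines "q \<equiv> BH_exponent n"
  shows "(\<Sum>i\<in>{1..n} \<rightarrow>\<^sub>E {1..N}. \<bar>form_coeff n N U i\<bar> powr q) powr (1 / q) \<le> C * form_norm n N U"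
proof (rule field_le_epsilon)
  fix e :: real assume e: "e > 0"
  define B where "B = form_norm n N U + e / C"
  have q: "q > 0" using assms(4) by (simp add: q_def BH_exponent_def)
  have signs: "\<bar>U (tuple n N z)\<bar> \<le> form_norm n N U" if "\<And>k j. \<bar>z k j\<bar> = 1" for z
    using form_norm_upper_signs [OF U assms(4,5) that] .
  have B: "B > 0"
    using signs [of "\<lambda>_ _. 1"] e C by (simp add: B_def add_nonneg_pos order_trans [OF abs_ge_zero])
  have "sign_contractive {1..n} {1..N} (\<lambda>i. form_coeff n N U i / B)"
    unfolding sign_contractive_def
  proof (intro allI impI)
    fix z :: "nat \<Rightarrow> nat \<Rightarrow> real"
    assume "\<forall>k j. \<bar>z k j\<bar> = 1"
    then have "\<bar>U (tuple n N z)\<bar> \<le> B"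
      using signs [of z] e C by (simp add: B_def add_increasing2)
    moreover have "(\<Sum>g\<in>{1..n} \<rightarrow>\<^sub>E {1..N}. form_coeff n N U g / B * (\<Prod>k\<in>{1..n}. z k (g k))) =
        U (tuple n N z) / B"
      by (simp add: multilinear_form_expansion [OF U] sum_divide_distrib)
    ultimately show "\<bar>\<Sum>g\<in>{1..n} \<rightarrow>\<^sub>E {1..N}. form_coeff n N U g / B * (\<Prod>k\<in>{1..n}. z k (g k))\<bar> \<le> 1"
      using B by simp
  qed
  from BH [unfolded BH_bound_def, rule_format, OF this]
  have "(\<Sum>g\<in>{1..n} \<rightarrow>\<^sub>E {1..N}. \<bar>form_coeff n N U g / B\<bar> powr q) \<le> C powr q"
    by (simp add: q_def)
  then have "(\<Sum>g\<in>{1..n} \<rightarrow>\<^sub>E {1..N}. \<bar>form_coeff n N U g\<bar> powr q) / B powr q \<le> C powr q"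
    using B by (simp add: powr_divide sum_divide_distrib)
  then have "(\<Sum>g\<in>{1..n} \<rightarrow>\<^sub>E {1..N}. \<bar>form_coeff n N U g\<bar> powr q) \<le> (C * B) powr q"
    using B C by (simp add: powr_mult field_simps)
  then have "(\<Sum>g\<in>{1..n} \<rightarrow>\<^sub>E {1..N}. \<bar>form_coeff n N U g\<bar> powr q) powr (1 / q) \<le> ((C * B) powr q) powr (1 / q)"
    using q by (intro powr_mono2) (auto intro: sum_nonneg)
  also have "\<dots> = C * B"
    using q B C by (simp add: powr_powr)
  also have "\<dots> = C * form_norm n N U + e"
    using C by (simp add: B_def field_simps)
  finally show "(\<Sum>i\<in>{1..n} \<rightarrow>\<^sub>E {1..N}. \<bar>form_coeff n N U i\<bar> powr q) powr (1 / q) \<le> C * form_norm n N U + e" .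
qed

lemma form_norm_nonneg:
  assumes "multilinear_form n N U" "n \<ge> 1" "N \<ge> 1"
  shows "0 \<le> form_norm n N U"
  using form_norm_upper_signs [OF assms, of "\<lambda>_ _. 1"] by (simp add: order_trans [OF abs_ge_zero])

theorem satisfies_BH_of_sqrt_le:
  assumes "1 \<le> C 1" and C: "\<And>n. n \<ge> 2 \<Longrightarrow> sqrt (2 * (real n - 1)) \<le> C n"
  shows "satisfies_BH C"
  unfolding satisfies_BH_def
proof (intro conjI allI impI)
  fix n :: nat assume n: "n \<ge> 1"
  define c where "c = (if n = 1 then 1 else sqrt (2 * (real n - 1)))"
  have c: "1 \<le> c" "c \<le> C n"
    using n assms by (auto simp: c_def real_le_rsqrt)
  then show "1 \<le> C n" by simp
  fix N :: nat and U assume N: "N \<ge> 1" and U: "multilinear_form n N U"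
  have "BH_bound {1..n} {1..N} c"
    using BH_bound_one [of "{1..n}"] BH_bound_sqrt [of "{1..n}" "{1..N}"] n by (auto simp: c_def)
  then have "(\<Sum>i\<in>{1..n} \<rightarrow>\<^sub>E {1..N}. \<bar>form_coeff n N U i\<bar> powr BH_exponent n) powr (1 / BH_exponent n)
      \<le> c * form_norm n N U"
    using c U n N by (intro BH_bound_imp_multilinear) auto
  also have "\<dots> \<le> C n * form_norm n N U"
    using c form_norm_nonneg [OF U n N] by (intro mult_right_mono) auto
  finally show "(\<Sum>i\<in>{1..n} \<rightarrow>\<^sub>E {1..N}.
        \<bar>U (\<lambda>k\<in>{1..n}. canonical_vec N (i k))\<bar> powr (2 * real n / (real n + 1)))
      powr ((real n + 1) / (2 * real n)) \<le> C n * form_norm n N U"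
    by (simp add: form_coeff_def BH_exponent_def)
qed

declare One_nat_def [simp]

section \<open>A lower bound for Euler's constant\<close>

text \<open>The beginning of the asymptotic expansion of \<open>\<gamma>\<close> at infinity; the summand \<open>6/5\<close> also accounts for
  its term \<open>- 1 / (120 n\<^sup>4)\<close>. The sequence is increasing with error of order \<open>n ^ (- 6)\<close>, about
  \<open>1.2 * 10 ^ (- 8)\<close> at \<open>n = 8\<close>.\<close>

definition gamma_lower :: "nat \<Rightarrow> real" where
  "gamma_lower n = harm n - ln (real n) - 1 / (2 * real n) + 1 / (12 * (real n)\<^sup>2 + 6/5)"

lemma ln_Suc_ratio_le:
  fixes x :: real
  assumes "x > 0"
  shows "ln ((x + 1) / x) \<le> 2 / (2 * x + 1) + 2 / (3 * (2 * x + 1) ^ 3) +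
    2 / (5 * (2 * x + 1) ^ 5) + 2 / (7 * (2 * x + 1) ^ 5 * ((2 * x + 1)\<^sup>2 - 1))"
proof -
  have y: "((x + 1) / x - 1) / ((x + 1) / x + 1) = 1 / (2 * x + 1)"
    using assms by (simp add: divide_simps)
  let ?y = "1 / (2 * x + 1)"
  have "ln ((x + 1) / x) \<le> (\<Sum>k<3. 2 * ?y ^ (2 * k + 1) / real (2 * k + 1)) +
      2 * (?y ^ (2 * 3 + 1) / (1 - ?y\<^sup>2) / real (2 * 3 + 1))"
    using ln_approx_bounds [of "(x + 1) / x" 3] assms unfolding y by simp
  also have "\<dots> = 2 / (2 * x + 1) + 2 / (3 * (2 * x + 1) ^ 3) +
    2 / (5 * (2 * x + 1) ^ 5) + 2 * (?y ^ 7 / (1 - ?y\<^sup>2) / 7)"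
    by (simp add: eval_nat_numeral power_divide)
  also have "?y ^ 7 / (1 - ?y\<^sup>2) = 1 / ((2 * x + 1) ^ 5 * ((2 * x + 1)\<^sup>2 - 1))"
  proof -
    define z where "z = 2 * x + 1"
    have "z > 1" using assms by (simp add: z_def)
    then have "1 < z\<^sup>2" by (rule one_less_power) simp
    then have "z\<^sup>2 - 1 \<noteq> 0" "z \<noteq> 0" using \<open>z > 1\<close> by linarith+
    then show ?thesis unfolding z_def [symmetric]
      by (simp add: power_divide divide_simps)
  qed
  finally show ?thesis by (simp add: field_simps)
qed

text \<open>Here \<open>z = 2 n + 1\<close>: the left-hand side bounds \<open>ln ((n + 1) / n)\<close>, the right-hand side is what the
  rational terms of \<open>gamma_lower\<close> gain from \<open>n\<close> to \<open>n + 1\<close>. After cross-multiplication the difference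
  is a polynomial in \<open>z\<^sup>2\<close> with positive coefficients.\<close>

lemma gamma_lower_increment:
  fixes z :: real
  assumes "z > 1"
  shows "2 / z + 2 / (3 * z ^ 3) + 2 / (5 * z ^ 5) + 2 / (7 * z ^ 5 * (z\<^sup>2 - 1)) \<le>
    2 * z / (z\<^sup>2 - 1) - 12 * z / (9 * z ^ 4 - 54/5 * z\<^sup>2 + 441/25)"
proof -
  define s where "s = z\<^sup>2 - 1"
  define P where "P = 9 * z ^ 4 - 54/5 * z\<^sup>2 + 441/25"
  define Q where "Q = 4 * (z ^ 4 / 3 + z\<^sup>2 / 15 + 1 / 35)"
  have s: "s > 0" using power_strict_mono [of 1 z 2] assms by (simp add: s_def)
  have "P = 9 * (z\<^sup>2 - 3/5)\<^sup>2 + 72/5"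
    by (simp add: P_def power2_eq_square power4_eq_xxxx algebra_simps)
  then have P: "P > 0" by (simp add: add_nonneg_pos)
  have "2 * z / s - (2 / z + 2 / (3 * z ^ 3) + 2 / (5 * z ^ 5) + 2 / (7 * z ^ 5 * s)) =
      (2 * z ^ 6 - s * (2 * z ^ 4 + 2/3 * z\<^sup>2 + 2/5) - 2/7) / (z ^ 5 * s)"
    using assms s by (simp add: field_simps eval_nat_numeral)
  also have "2 * z ^ 6 - s * (2 * z ^ 4 + 2/3 * z\<^sup>2 + 2/5) - 2/7 = Q"
    unfolding s_def Q_def by algebra
  finally have 1: "2 * z / s - (2 / z + 2 / (3 * z ^ 3) + 2 / (5 * z ^ 5) + 2 / (7 * z ^ 5 * s)) =
      Q / (z ^ 5 * s)" .
  have "Q * P - 12 * z * (z ^ 5 * s) = 4 * (948/175 * z ^ 4 + 759/875 * z\<^sup>2 + 63/125)"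
    unfolding Q_def P_def s_def by algebra
  moreover have "\<dots> \<ge> 0" by simp
  ultimately have "12 * z * (z ^ 5 * s) \<le> Q * P" by linarith
  then have "12 * z / P \<le> Q / (z ^ 5 * s)"
    using P s assms by (simp add: divide_simps)
  with 1 show ?thesis unfolding P_def [symmetric] s_def [symmetric] by linarith
qed

lemma gamma_lower_step:
  assumes "n \<ge> 1"
  shows "gamma_lower n \<le> gamma_lower (Suc n)"
proof -
  define x where "x = real n"
  have x: "x \<ge> 1" using assms by (simp add: x_def)
  have harm: "1 / (x + 1) - 1 / (2 * (x + 1)) + 1 / (2 * x) = 2 * (2 * x + 1) / ((2 * x + 1)\<^sup>2 - 1)"
  proof -
    have "(2 * x + 1)\<^sup>2 - 1 = 4 * x * (x + 1)" by algebra
    then show ?thesis using x by (simp add: divide_simps)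
  qed
  have rational: "1 / (12 * (x + 1)\<^sup>2 + 6/5) - 1 / (12 * x\<^sup>2 + 6/5) =
      - (12 * (2 * x + 1) / (9 * (2 * x + 1) ^ 4 - 54/5 * (2 * x + 1)\<^sup>2 + 441/25))"
  proof -
    have pos: "12 * (x + 1)\<^sup>2 + 6/5 > 0" "12 * x\<^sup>2 + 6/5 > 0"
      by (simp_all add: add_nonneg_pos)
    have "9 * (2 * x + 1) ^ 4 - 54/5 * (2 * x + 1)\<^sup>2 + 441/25 =
        (12 * (x + 1)\<^sup>2 + 6/5) * (12 * x\<^sup>2 + 6/5)"
      by algebra
    moreover have "12 * (2 * x + 1) = (12 * (x + 1)\<^sup>2 + 6/5) - (12 * x\<^sup>2 + 6/5)"
      by algebra
    moreover have "1 / a - 1 / b = - ((a - b) / (a * b))" if "a > 0" "b > 0" for a b :: real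
      using that by (simp add: field_simps)
    ultimately show ?thesis using pos by simp
  qed
  have "ln ((x + 1) / x) = ln (x + 1) - ln x"
    using x by (simp add: ln_div)
  then have "ln (x + 1) - ln x \<le> 1 / (x + 1) - 1 / (2 * (x + 1)) + 1 / (2 * x) +
      (1 / (12 * (x + 1)\<^sup>2 + 6/5) - 1 / (12 * x\<^sup>2 + 6/5))"
    unfolding harm rational using ln_Suc_ratio_le [of x] gamma_lower_increment [of "2 * x + 1"] x by simp
  moreover have "gamma_lower n = harm n - ln x - 1 / (2 * x) + 1 / (12 * x\<^sup>2 + 6/5)"
    by (simp only: gamma_lower_def x_def)
  moreover have "gamma_lower (Suc n) = harm n + 1 / (x + 1) - ln (x + 1) - 1 / (2 * (x + 1)) +
      1 / (12 * (x + 1)\<^sup>2 + 6/5)"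
    by (simp only: gamma_lower_def harm_Suc x_def of_nat_Suc inverse_eq_divide add.commute)
  ultimately show ?thesis by linarith
qed

lemma gamma_lower_le: "n \<ge> 1 \<Longrightarrow> gamma_lower n \<le> euler_mascheroni"
proof -
  assume n: "n \<ge> 1"
  have lim: "gamma_lower \<longlonglongrightarrow> euler_mascheroni - 0 + 0"
    unfolding gamma_lower_def
  proof (intro tendsto_add tendsto_diff)
    show "(\<lambda>n. harm n - ln (real n)) \<longlonglongrightarrow> euler_mascheroni"
      by (rule euler_mascheroni_LIMSEQ)
    show "(\<lambda>n. 1 / (2 * real n)) \<longlonglongrightarrow> 0"
      using lim_const_over_n [of "1/2 :: real"] by simp
    show "(\<lambda>n. 1 / (12 * (real n)\<^sup>2 + 6/5)) \<longlonglongrightarrow> 0"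
    proof (rule Lim_null_comparison)
      show "\<forall>\<^sub>F n in sequentially. norm (1 / (12 * (real n)\<^sup>2 + 6/5)) \<le> 1 / real n"
      proof (rule eventually_sequentiallyI [of 1])
        fix n :: nat assume n: "1 \<le> n"
        have "real n \<le> (real n)\<^sup>2"
          using n by (intro self_le_power) auto
        then have "real n \<le> 12 * (real n)\<^sup>2 + 6/5"
          by linarith
        then show "norm (1 / (12 * (real n)\<^sup>2 + 6/5)) \<le> 1 / real n"
          using n by (simp add: divide_left_mono)
      qed
    qed (rule lim_1_over_n)
  qed
  have "gamma_lower n \<le> gamma_lower m" if "n \<le> m" for m
    using that by (induction m rule: dec_induct) (use n gamma_lower_step order_trans in \<open>auto intro: order_trans\<close>)
  then show ?thesis
    using lim by (intro LIMSEQ_le_const [where X = gamma_lower]) auto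
qed

section \<open>The dyadically linear sequence\<close>

lemma D_const_pos: "D_const > 0"
  by (simp add: D_const_def)

lemma ln_D_const: "ln D_const = 1 - euler_mascheroni / 2 - ln 2 / 2"
  by (simp add: D_const_def ln_div ln_sqrt)

lemma D_const_bounds: "1.43 \<le> D_const" "D_const \<le> 1.444"
proof -
  have ln2: "ln (2::real) \<le> 6932/10000" "ln (2::real) \<ge> 6931/10000"
    using ln_approx_bounds [of 2 4] by (simp_all add: eval_nat_numeral)
  have "ln (1.43 :: real) \<le> 0.3578"
    using ln_approx_bounds [of "1.43" 3] by (simp add: eval_nat_numeral)
  also have "\<dots> \<le> ln D_const"
    using euler_mascheroni_less_13_over_22 ln2 by (simp add: ln_D_const)
  finally show "1.43 \<le> D_const"
    using D_const_pos by simp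
  have "ln D_const \<le> 0.367"
    using euler_mascheroni_gt_19_over_33 ln2 by (simp add: ln_D_const)
  also have "\<dots> \<le> ln (1.444 :: real)"
    using ln_approx_bounds [of "1.444" 3] by (simp add: eval_nat_numeral)
  finally show "D_const \<le> 1.444"
    using D_const_pos by simp
qed

text \<open>The true value is about \<open>-0.473678048\<close>, so seven correct digits of \<open>\<gamma>\<close> are required.\<close>

lemma log_half_D_const_le: "log 2 (D_const / 2) \<le> - 0.473678"
proof -
  have ln2: "ln (2::real) \<le> 0.693147182"
    using ln_approx_bounds [of 2 9] by (simp add: eval_nat_numeral)
  have "harm 8 = (761/280 :: real)"
    by (simp add: harm_expand)
  moreover have "ln (8::real) = 3 * ln 2"
    using ln_realpow [of 2 3] by simp
  ultimately have "761/280 - 3 * ln 2 - 1/16 + 5/3846 \<le> (euler_mascheroni :: real)"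
    using gamma_lower_le [of 8] by (simp add: gamma_lower_def)
  then have "1 - euler_mascheroni / 2 - ln 2 / 2 - ln 2 \<le> - 0.473678 * ln (2::real)"
    using ln2 by simp
  then have "ln (D_const / 2) \<le> - 0.473678 * ln 2"
    using D_const_pos by (simp add: ln_div ln_D_const)
  then show ?thesis
    by (simp add: log_def field_simps)
qed

text \<open>In \<open>m = n - 1\<close> the sequence interpolates linearly between the values \<open>sqrt 2 * D ^ j\<close> at \<open>m = 2 ^ j\<close>;
  the two formulas that meet at \<open>m = 2 ^ Suc j\<close> agree.\<close>

lemma R_Suc:
  assumes "2 ^ j \<le> m" "m \<le> 2 ^ Suc j"
  shows "R (Suc m) = sqrt 2 * D_const ^ j * (1 + (real m / 2 ^ j - 1) * (D_const - 1))"
proof (cases "m = 2 ^ Suc j")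
  case True
  have "Suc m \<in> dyadic_block (j + 2)"
    using True by (simp add: dyadic_block_def)
  then have "R (Suc m) = sqrt 2 * D_const ^ Suc j"
    using R_block [of "j + 2" "Suc m"] True by simp
  then show ?thesis
    using True by (simp add: algebra_simps)
next
  case False
  have "Suc m \<in> dyadic_block (Suc j)"
    using False assms by (simp add: dyadic_block_def)
  then have "R (Suc m) = sqrt 2 * (D_const ^ j + (real (Suc m - 2 ^ j) - 1) * ((D_const ^ Suc j - D_const ^ j) / 2 ^ j))"
    using R_block [of "Suc j" "Suc m"] by simp
  moreover have "real (Suc m - 2 ^ j) - 1 = real m - 2 ^ j"
    using assms(1) by (simp add: of_nat_diff)
  ultimately show ?thesis
    by (simp add: field_simps)
qed

lemma R_difference:
  assumes "2 ^ j < n" "n \<le> 2 ^ Suc j"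
  shows "R (Suc n) - R n = sqrt 2 * (D_const - 1) * (D_const / 2) ^ j"
proof -
  obtain m where m: "n = Suc m" using assms(1) by (cases n) auto
  have "R (Suc n) = sqrt 2 * D_const ^ j * (1 + (real n / 2 ^ j - 1) * (D_const - 1))"
    "R n = sqrt 2 * D_const ^ j * (1 + (real m / 2 ^ j - 1) * (D_const - 1))"
    using R_Suc [of j n] R_Suc [of j m] assms by (auto simp: m)
  then show ?thesis
    by (simp add: m power_divide field_simps)
qed

lemma R_one: "R 1 = 1" and R_two: "R 2 = sqrt 2"
  using R_Suc [of 0 1] by (simp_all add: R_def numeral_2_eq_2)

lemma R_first_difference: "R (1 + 1) - R 1 = sqrt 2 - 1"
  by (simp only: one_add_one R_one R_two)

text \<open>At \<open>m = n - 1 = x * 2 ^ j\<close> the claim is \<open>sqrt m \<le> D ^ j (1 + (x - 1) (D - 1))\<close>. It fails for \<open>j = 0\<close>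
  and \<open>x\<close> in the middle of \<open>[1, 2]\<close>, where \<open>m\<close> is not an integer; for \<open>j \<ge> 1\<close> the factor \<open>D / sqrt 2\<close>
  gives enough room, and \<open>sqrt (2 x)\<close> is replaced by a tangent line.\<close>

lemma sqrt_le_R:
  assumes "n \<ge> 2"
  shows "sqrt (2 * (real n - 1)) \<le> R n"
proof -
  obtain m where m: "n = Suc m" "m \<ge> 1" using assms by (cases n) auto
  obtain j where j: "2 ^ j \<le> m" "m < 2 ^ (j + 1)"
    using ex_power_ivl1 [of 2 m] m by auto
  have D: "1.43 \<le> D_const" by (rule D_const_bounds)
  show ?thesis
  proof (cases j)
    case 0
    then have "n = 2" using j m by simp
    then show ?thesis using R_two by simp
  next
    case (Suc i)
    define x where "x = real m / 2 ^ j"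
    have x: "1 \<le> x" "x \<le> 2"
      using j of_nat_mono [OF j(1), where 'a = real] of_nat_mono [OF less_imp_le [OF j(2)], where 'a = real]
      by (auto simp: x_def divide_simps)
    (* The tangent at x = 1.3448 is below D (1 + (x - 1) (D - 1)) at both ends of [1, 2] once D is at
       least 1.43. *)
    have "sqrt (2 * x) \<le> x / 1.64 + 0.82"
    proof (rule real_le_lsqrt)
      have "(x / 1.64 + 0.82)\<^sup>2 - 2 * x = (x / 1.64 - 0.82)\<^sup>2"
        by (simp add: power2_eq_square algebra_simps)
      then show "2 * x \<le> (x / 1.64 + 0.82)\<^sup>2"
        using zero_le_power2 [of "x / 1.64 - 0.82"] by linarith
    qed (use x in auto)
    also have "\<dots> \<le> 1.43 * (1 + (x - 1) * 0.43)"
      using x by (simp add: field_simps)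
    also have "\<dots> \<le> D_const * (1 + (x - 1) * (D_const - 1))"
      using D x by (intro mult_mono add_mono) auto
    finally have "sqrt 2 ^ i * sqrt (2 * x) \<le> D_const ^ i * (D_const * (1 + (x - 1) * (D_const - 1)))"
    proof (intro mult_mono power_mono)
      have "sqrt 2 \<le> 1.43" by (rule real_le_lsqrt) (auto simp: power2_eq_square)
      then show "sqrt 2 \<le> D_const" using D by simp
    qed (use D x in auto)
    moreover have "sqrt 2 ^ i * sqrt (2 * x) = sqrt (real m)"
      by (simp add: real_sqrt_power [symmetric] real_sqrt_mult [symmetric] x_def Suc del: real_sqrt_eq_iff)
    ultimately have "sqrt (real m) \<le> D_const ^ j * (1 + (x - 1) * (D_const - 1))"
      by (simp add: Suc mult_ac)
    then show ?thesis
      using R_Suc [of j m] j by (simp add: m x_def real_sqrt_mult mult.assoc)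
  qed
qed

lemma R_differences_antimono: "antimono_on {2..} (\<lambda>n. R (n + 1) - R n)"
proof (rule monotone_onI)
  fix m n :: nat
  assume mn: "m \<in> {2..}" "n \<in> {2..}" "m \<le> n"
  obtain i where i: "2 ^ i < m" "m \<le> 2 ^ (i + 1)"
    using ex_power_ivl2 [of 2 m] mn by auto
  obtain j where j: "2 ^ j < n" "n \<le> 2 ^ (j + 1)"
    using ex_power_ivl2 [of 2 n] mn by auto
  have "(2::nat) ^ i < 2 ^ (j + 1)" using i j mn by linarith
  then have "i < j + 1" using power_less_imp_less_exp [of "2::nat" i "j + 1"] by linarith
  then have "i \<le> j" by simp
  then have "(D_const / 2) ^ j \<le> (D_const / 2) ^ i"
    using D_const_bounds by (intro power_decreasing) auto
  then show "R (n + 1) - R n \<le> R (m + 1) - R m"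
    using R_difference [of i m] R_difference [of j n] i j D_const_bounds
    by (auto intro!: mult_left_mono)
qed

text \<open>Equality holds at \<open>n = 2 ^ (j + 1)\<close>; on the rest of the block the left-hand side is constant and the
  right-hand side decreases in \<open>n\<close>.\<close>

lemma R_difference_le:
  assumes "n \<ge> 1"
  shows "R (n + 1) - R n \<le> 2 * sqrt 2 * (1 - 1 / D_const) * real n powr log 2 (D_const / 2)"
proof (cases "n = 1")
  case True
  have "0.3 \<le> 1 - 1 / D_const"
    using D_const_bounds by (simp add: field_simps)
  then have "2 * sqrt 2 * 0.3 \<le> 2 * sqrt 2 * (1 - 1 / D_const)"
    by (intro mult_left_mono) auto
  moreover have "sqrt 2 \<le> 1.5" by (rule real_le_lsqrt) (auto simp: power2_eq_square)
  ultimately have "sqrt 2 - 1 \<le> 2 * sqrt 2 * (1 - 1 / D_const)" by linarith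
  then show ?thesis
    unfolding True R_first_difference by simp
next
  case False
  obtain j where j: "2 ^ j < n" "n \<le> 2 ^ (j + 1)"
    using ex_power_ivl2 [of 2 n] assms False by auto
  have n: "0 < real n" "real n \<le> 2 ^ (j + 1)"
    using assms of_nat_mono [OF j(2), where 'a = real] by auto
  have "2 * sqrt 2 * (1 - 1 / D_const) * (D_const / 2) ^ (j + 1) =
      sqrt 2 * (D_const - 1) * (D_const / 2) ^ j"
    using D_const_pos by (simp add: field_simps)
  then have "R (n + 1) - R n = 2 * sqrt 2 * (1 - 1 / D_const) * (D_const / 2) ^ (j + 1)"
    using R_difference [of j n] j by (simp only: Suc_eq_plus1)
  also have "(D_const / 2) ^ (j + 1) = (2 ^ (j + 1)) powr log 2 (D_const / 2)"
  proof -
    have "(2 ^ (j + 1)) powr log 2 (D_const / 2) = (2 powr real (j + 1)) powr log 2 (D_const / 2)"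
      by (simp only: powr_realpow zero_less_numeral)
    also have "\<dots> = (2 powr log 2 (D_const / 2)) powr real (j + 1)"
      by (simp only: powr_powr mult.commute)
    also have "\<dots> = (D_const / 2) powr real (j + 1)"
      using D_const_pos by simp
    also have "\<dots> = (D_const / 2) ^ (j + 1)"
      using D_const_pos by (intro powr_realpow) simp
    finally show ?thesis ..
  qed
  also have "2 * sqrt 2 * (1 - 1 / D_const) * (2 ^ (j + 1)) powr log 2 (D_const / 2) \<le>
      2 * sqrt 2 * (1 - 1 / D_const) * real n powr log 2 (D_const / 2)"
    using n log_half_D_const_le D_const_bounds
    by (intro mult_left_mono powr_mono2') auto
  finally show ?thesis .
qed

lemma R_difference_nonneg: "n \<ge> 1 \<Longrightarrow> 0 \<le> R (n + 1) - R n"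
proof (cases "n = 1")
  case True
  show ?thesis unfolding True R_first_difference by simp
next
  assume "n \<ge> 1"
  case False
  then obtain j where "2 ^ j < n" "n \<le> 2 ^ (j + 1)"
    using ex_power_ivl2 [of 2 n] \<open>n \<ge> 1\<close> by auto
  then show ?thesis
    using R_difference [of j n] D_const_bounds by simp
qed

lemma R_differences_tendsto_0: "(\<lambda>n. R (n + 1) - R n) \<longlonglongrightarrow> 0"
proof (rule tendsto_sandwich [OF _ _ tendsto_const])
  show "\<forall>\<^sub>F n in sequentially. 0 \<le> R (n + 1) - R n"
    using R_difference_nonneg by (auto simp: eventually_sequentially)
  show "\<forall>\<^sub>F n in sequentially. R (n + 1) - R n \<le>
      2 * sqrt 2 * (1 - 1 / D_const) * real n powr log 2 (D_const / 2)"
    using R_difference_le by (auto simp: eventually_sequentially)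
  have "(\<lambda>n. real n powr log 2 (D_const / 2)) \<longlonglongrightarrow> 0"
    using log_half_D_const_le by (intro tendsto_neg_powr filterlim_real_sequentially) auto
  then show "(\<lambda>n. 2 * sqrt 2 * (1 - 1 / D_const) * real n powr log 2 (D_const / 2)) \<longlonglongrightarrow> 0"
    by (rule tendsto_mult_right_zero)
qed

lemma R_difference_less:
  assumes "n \<ge> 1"
  shows "R (n + 1) - R n < 0.87 / real n powr 0.473678"
proof -
  have "sqrt 2 \<le> 1.4143" by (rule real_le_lsqrt) (auto simp: power2_eq_square)
  moreover have "1 - 1 / D_const \<le> 0.3075"
    using D_const_bounds by (simp add: field_simps)
  ultimately have "2 * sqrt 2 * (1 - 1 / D_const) \<le> 2 * 1.4143 * 0.3075"
    using D_const_bounds by (intro mult_mono) auto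
  then have c: "2 * sqrt 2 * (1 - 1 / D_const) < 0.87" by simp
  have "R (n + 1) - R n \<le> 2 * sqrt 2 * (1 - 1 / D_const) * real n powr log 2 (D_const / 2)"
    by (rule R_difference_le [OF assms])
  also have "\<dots> \<le> 2 * sqrt 2 * (1 - 1 / D_const) * real n powr (- 0.473678)"
    using assms D_const_bounds log_half_D_const_le by (intro mult_left_mono powr_mono) auto
  also have "\<dots> < 0.87 * real n powr (- 0.473678)"
    using assms c by (intro mult_strict_right_mono) auto
  finally show ?thesis
    by (simp add: powr_minus_divide)
qed

lemma D_const_rewrite:
  "2 * sqrt 2 * (1 - 1 / D_const) = 2 * sqrt 2 - 4 * exp (euler_mascheroni / 2 - 1)"
  "D_const / 2 = 2 powr (-3/2) * exp (1 - euler_mascheroni / 2)"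
proof -
  have exp_eq: "exp (euler_mascheroni / 2 - 1) = 1 / exp (1 - euler_mascheroni / 2 :: real)"
    using exp_minus [of "1 - euler_mascheroni / 2 :: real"] by (simp add: inverse_eq_divide)
  have "1 / D_const = sqrt 2 * exp (euler_mascheroni / 2 - 1)"
    unfolding exp_eq D_const_def by simp
  then show "2 * sqrt 2 * (1 - 1 / D_const) = 2 * sqrt 2 - 4 * exp (euler_mascheroni / 2 - 1)"
    by (simp add: right_diff_distrib)
  have "(2::real) powr (3/2) = 2 powr (1 + 1/2)" by simp
  also have "\<dots> = 2 * sqrt 2" unfolding powr_add by (simp add: powr_half_sqrt)
  finally have "(2::real) powr (-3/2) = 1 / (2 * sqrt 2)"
    using powr_minus_divide [of 2 "3/2 :: real"] by simp
  then show "D_const / 2 = 2 powr (-3/2) * exp (1 - euler_mascheroni / 2)"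
    by (simp add: D_const_def)
qed

theorem theorem7p2:
  shows "satisfies_BH R
    \<and> antimono_on {2..} (\<lambda>n. R (n + 1) - R n)
    \<and> (\<lambda>n. R (n + 1) - R n) \<longlonglongrightarrow> 0
    \<and> (\<forall>n\<ge>1. R (n + 1) - R n
          \<le> (2 * sqrt 2 - 4 * exp (euler_mascheroni / 2 - 1))
              * real n powr log 2 (2 powr (-3/2) * exp (1 - euler_mascheroni / 2)))
    \<and> (\<forall>n\<ge>1. R (n + 1) - R n < 0.87 / real n powr 0.473678)"
  using satisfies_BH_of_sqrt_le [of R] R_one sqrt_le_R R_differences_antimono
    R_differences_tendsto_0 R_difference_le R_difference_less
  unfolding D_const_rewrite by simp

end
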